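(* Let $A$ and $B$ be mutually semiconjugate rational functions of degree at least two, and let $X$, $Y$ be non-constant rational functions such that $$B\circ Y=Y\circ A,\qquad A\circ X=X\circ B .$$ Assume that there exists an orbifold $\mathcal O=(\mathbb{CP}^1,\nu)$ with signature distinct from $(2,2,2,2)$ such that $A:\mathcal O\to\mathcal O$ and $X\circ Y:\mathcal O\to\mathcal O$ are covering maps between orbifolds. Then $B$ is conjugate to $A$.
   Context: Rational functions have complex coefficients and are regarded as holomorphic maps $\mathbb{CP}^1\to\mathbb{CP}^1$. Semiconjugacy: a rational function $B$ is semiconjugate to a rational function $A$ if there exists a non-constant rational function $X$ such that $A\circ X=X\circ B$; if $X$ can be chosen to be invertible (a Möbius transformation), $A$ and $B$ are called conjugate. $A$ and $B$ are mutually semiconjugate if $A$ is semiconjugate to $B$ and $B$ is semiconjugate to $A$. Orbifolds: an orbifold $\mathcal O=(\mathbb{CP}^1,\nu)$ is the Riemann sphere together with a ramification function $\nu:\mathbb{CP}^1\to\mathbb N\cup\{\infty\}$ (with values $\geq 1$; the value $\infty$ is allowed) such that $\nu(z)=1$ except at isolated (hence finitely many) points. Its signature is the unordered list, with repetitions, of the values $\nu(z)$ at points $z$ with $\nu(z)>1$. Covering maps: for orbifolds $\mathcal O_1=(\mathbb{CP}^1,\nu_1)$, $\mathcal O_2=(\mathbb{CP}^1,\nu_2)$, a non-constant rational function $f$ is a covering map $f:\mathcal O_1\to\mathcal O_2$ between orbifolds if $\nu_2(f(z))=\nu_1(z)\deg_z f$ for every $z\in\mathbb{CP}^1$, where $\deg_z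 f$ is the local degree of $f$ at $z$ and $k\cdot\infty=\infty$ for $k\ge 1$. *)

theory Defs
  imports
    "HOL-Complex_Analysis.Complex_Analysis"
    "HOL-Computational_Algebra.Polynomial_Factorial"
    "HOL-Computational_Algebra.Field_as_Ring"
    "HOL-Library.Extended_Nat"
    "HOL-Library.Multiset"
begin

section \<open>Rational functions as self-maps of the Riemann sphere\<close>

text \<open>
  The Riemann sphere is represented as the set underlying the one-point compactification of the
  complex plane (cf. \<open>Alexandroff_compactification\<close>): \<open>Some z\<close> is a finite
  point and \<open>None\<close> is the point at infinity.
\<close>

type_synonym sphere = "complex option"

text \<open>
  The map induced by the fraction \<open>p / q\<close>. The formulas are the right ones only if
  \<open>p\<close> and \<open>q\<close> are coprime: then a zero of \<open>q\<close> is a pole, and the value at infinity is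
  the quotient of the coefficients of degree \<open>max (degree p) (degree q)\<close>, which are not
  both zero.
\<close>

definition fraction_map :: "complex poly \<Rightarrow> complex poly \<Rightarrow> sphere \<Rightarrow> sphere" where
  "fraction_map p q x =
     (case x of
        Some z \<Rightarrow> if poly q z = 0 then None else Some (poly p z / poly q z)
      | None \<Rightarrow>
          (let n = max (degree p) (degree q)
           in if coeff q n = 0 then None else Some (coeff p n / coeff q n)))"

definition represents :: "complex poly \<Rightarrow> complex poly \<Rightarrow> (sphere \<Rightarrow> sphere) \<Rightarrow> bool" where
  "represents p q f \<longleftrightarrow> q \<noteq> 0 \<and> coprime p q \<and> f = fraction_map p q"

definition rational_function :: "(sphere \<Rightarrow> sphere) \<Rightarrow> bool" where
  "rational_function f \<longleftrightarrow> (\<exists>p q. represents p q f)"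

definition nonconstant :: "(sphere \<Rightarrow> sphere) \<Rightarrow> bool" where
  "nonconstant f \<longleftrightarrow> (\<nexists>c. \<forall>x. f x = c)"

definition rat_degree :: "(sphere \<Rightarrow> sphere) \<Rightarrow> nat" where
  "rat_degree f = (THE d. \<exists>p q. represents p q f \<and> d = max (degree p) (degree q))"

lemma represents_unique_degree:
  assumes "represents p q f" "represents r s f"
  shows "degree p = degree r" "degree q = degree s"
proof -
  have nz: "q \<noteq> 0" "s \<noteq> 0" and cop: "coprime p q" "coprime r s"
    and eq: "fraction_map p q = fraction_map r s"
    using assms by (auto simp: represents_def)
  have "poly (p * s - r * q) z = 0" if "poly (q * s) z \<noteq> 0" for z
    using fun_cong[OF eq, of "Some z"] that by (auto simp: fraction_map_def field_simps)
  hence "poly ((p * s - r * q) * (q * s)) z = 0" for z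
    by (cases "poly (q * s) z = 0") auto
  hence "(p * s - r * q) * (q * s) = 0"
    using poly_all_0_iff_0 by blast
  hence ps: "p * s = r * q" using nz by auto
  have "q dvd p * s" "s dvd r * q"
    using ps by (metis dvd_triv_right)+
  hence "q dvd s" "s dvd q"
    using cop by (metis coprime_commute coprime_dvd_mult_right_iff)+
  thus "degree q = degree s"
    using nz by (simp add: dvd_imp_degree_le order_antisym)
  have "p dvd r * q" "r dvd p * s"
    using ps by (metis dvd_triv_left)+
  hence "p dvd r" "r dvd p"
    using cop by (metis coprime_commute coprime_dvd_mult_left_iff)+
  thus "degree p = degree r"
    by (cases "p = 0 \<or> r = 0") (auto simp: dvd_imp_degree_le order_antisym)
qed

lemma rat_degree_eq:
  assumes "represents p q f"
  shows "rat_degree f = max (degree p) (degree q)"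
  unfolding rat_degree_def
proof (rule the_equality)
  fix d assume "\<exists>p q. represents p q f \<and> d = max (degree p) (degree q)"
  then show "d = max (degree p) (degree q)"
    using represents_unique_degree[OF assms] by auto
qed (use assms in blast)

section \<open>Semiconjugacy\<close>

definition semiconjugate :: "(sphere \<Rightarrow> sphere) \<Rightarrow> (sphere \<Rightarrow> sphere) \<Rightarrow> bool" where
  "semiconjugate B A \<longleftrightarrow>
     (\<exists>X. rational_function X \<and> nonconstant X \<and> A \<circ> X = X \<circ> B)"

definition mutually_semiconjugate :: "(sphere \<Rightarrow> sphere) \<Rightarrow> (sphere \<Rightarrow> sphere) \<Rightarrow> bool" where
  "mutually_semiconjugate A B \<longleftrightarrow> semiconjugate A B \<and> semiconjugate B A"

definition invertible_rational :: "(sphere \<Rightarrow> sphere) \<Rightarrow> bool" where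
  "invertible_rational X \<longleftrightarrow>
     rational_function X \<and> (\<exists>Y. rational_function Y \<and> X \<circ> Y = id \<and> Y \<circ> X = id)"

definition conjugate :: "(sphere \<Rightarrow> sphere) \<Rightarrow> (sphere \<Rightarrow> sphere) \<Rightarrow> bool" where
  "conjugate B A \<longleftrightarrow> (\<exists>X. invertible_rational X \<and> A \<circ> X = X \<circ> B)"

section \<open>Local degree\<close>

text \<open>
  \<open>chart a\<close> is a local coordinate on the sphere centred at \<open>a\<close>, namely \<open>z - a\<close> at a finite
  point and \<open>1 / z\<close> at infinity, and \<open>param a\<close> is its inverse. The chart is meaningless at
  exactly one point (\<open>None\<close> for finite \<open>a\<close>, and \<open>Some 0\<close> for \<open>a = None\<close>), where it takes the dummy
  value 0; this point is bounded away from \<open>a\<close>, so it does not affect local notions at \<open>a\<close>.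
\<close>

definition chart :: "sphere \<Rightarrow> sphere \<Rightarrow> complex" where
  "chart a x =
     (case a of
        Some c \<Rightarrow> (case x of Some z \<Rightarrow> z - c | None \<Rightarrow> 0)
      | None \<Rightarrow> (case x of Some z \<Rightarrow> 1 / z | None \<Rightarrow> 0))"

definition param :: "sphere \<Rightarrow> complex \<Rightarrow> sphere" where
  "param a u =
     (case a of
        Some c \<Rightarrow> Some (c + u)
      | None \<Rightarrow> if u = 0 then None else Some (1 / u))"

text \<open>The order of vanishing at 0 of \<open>f\<close> read in centred coordinates at \<open>x\<close> and \<open>f x\<close>.\<close>

definition local_degree :: "(sphere \<Rightarrow> sphere) \<Rightarrow> sphere \<Rightarrow> nat" where
  "local_degree f x = nat (zorder (\<lambda>u. chart (f x) (f (param x u))) 0)"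

section \<open>Orbifolds\<close>

text \<open>An orbifold is given by its ramification function; by compactness of the sphere, the
  exceptional points being isolated means that there are finitely many of them.\<close>

definition orbifold :: "(sphere \<Rightarrow> enat) \<Rightarrow> bool" where
  "orbifold \<nu> \<longleftrightarrow> (\<forall>z. \<nu> z \<ge> 1) \<and> finite {z. \<nu> z \<noteq> 1}"

definition signature :: "(sphere \<Rightarrow> enat) \<Rightarrow> enat multiset" where
  "signature \<nu> = image_mset \<nu> (mset_set {z. \<nu> z > 1})"

text \<open>In \<^typ>\<open>enat\<close> we have \<open>\<infinity> * enat k = \<infinity>\<close> for \<open>k \<ge> 1\<close>.\<close>

definition orbifold_covering ::
    "(sphere \<Rightarrow> sphere) \<Rightarrow> (sphere \<Rightarrow> enat) \<Rightarrow> (sphere \<Rightarrow> enat) \<Rightarrow> bool" where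
  "orbifold_covering f \<nu>\<^sub>1 \<nu>\<^sub>2 \<longleftrightarrow>
     rational_function f \<and> nonconstant f \<and>
     (\<forall>z. \<nu>\<^sub>2 (f z) = \<nu>\<^sub>1 z * enat (local_degree f z))"

end

theory Submission
  imports Defs "HOL-Computational_Algebra.Fundamental_Theorem_Algebra"
begin

text \<open>
Write \<open>O\<close> for the given orbifold \<open>\<nu>\<close>. Since \<open>X \<circ> Y\<close> is a covering of \<open>O\<close> by
itself, it factors through an orbifold \<open>O'\<close> whose ramification function at \<open>w\<close> is
\<open>\<nu> (X w)\<close> divided by the local degree of \<open>X\<close> at \<open>w\<close>; the maps \<open>Y : O \<rightarrow> O'\<close>, \<open>X : O' \<rightarrow> O\<close> and
\<open>B : O' \<rightarrow> O'\<close> are coverings too (\<open>intermediate_orbifold\<close>).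

An orbifold with a self-covering of degree at least two has Euler characteristic zero
(\<open>euler_characteristic\<close>), so its signature is one of \<open>(\<infinity>,\<infinity>)\<close>, \<open>(2,2,\<infinity>)\<close>, \<open>(3,3,3)\<close>, \<open>(4,4,2)\<close>,
\<open>(6,3,2)\<close> or \<open>(2,2,2,2)\<close>. The last one is excluded for \<open>O\<close> by assumption and hence for \<open>O'\<close>, and
as each of \<open>O\<close> and \<open>O'\<close> covers the other, their signatures agree (\<open>euclidean_type_unique\<close>). With at
most three exceptional points, a Moebius transformation identifies \<open>O'\<close> with \<open>O\<close>; it can moreover be
chosen to respect any matching of the exceptional points that preserves their indices.

Classically one would now lift everything to affine maps \<open>z \<mapsto> a z + b\<close> of the universal covering \<open>\<complex>\<close>.
The proof below keeps only the part of this picture that is visible on the sphere. Let \<open>n\<close> be the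
least common multiple of the finite indices. The form \<open>dz\<^sup>n\<close> on \<open>\<complex>\<close> descends to a form
\<open>dz\<^sup>n / T(z)\<close> on the sphere, where \<open>T\<close> is an explicit polynomial. Pulling it back by a self-covering
\<open>f\<close> multiplies it by a nonzero constant, the multiplier of \<open>f\<close>, which is \<open>a\<^sup>n\<close> in the classical picture:
\<open>f'\<^sup>n T = multiplier * T(f)\<close> (\<open>multiplier_exists\<close>). Multipliers are multiplicative under composition, so
\<open>B \<circ> Y = Y \<circ> A\<close> forces \<open>A\<close> and \<open>B\<close> to have the same multiplier
(\<open>equal_multipliers_if_semiconjugate\<close>). A self-covering is determined by its multiplier together
with one value, provided that value is a point of index exactly \<open>n\<close>: there the leading coefficient of
the germ is determined without the ambiguity of an \<open>n\<close>-th root of unity, and so are all further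
ones (\<open>covering_determined_by_multiplier\<close>).

It remains to match a point of index \<open>n\<close> and its image for \<open>A\<close> and \<open>B\<close>, which is combinatorics. Points
of index \<open>n\<close> are mapped to such points by \<open>A\<close>, \<open>B\<close>, \<open>X\<close> and \<open>Y\<close>. If \<open>A\<close> fixes such a point \<open>s\<close>, then
\<open>B\<close> fixes \<open>Y s\<close>, and one matches \<open>s\<close> with \<open>Y s\<close>. If \<open>A\<close> fixes none, then neither does \<open>B\<close>, because \<open>X\<close>
would transport such a fixed point; then any two points \<open>p\<close>, \<open>p'\<close> of index \<open>n\<close> can be matched together
with their images \<open>A p \<noteq> p\<close> and \<open>B p' \<noteq> p'\<close>. The signature \<open>(\<infinity>,\<infinity>)\<close>, where \<open>n = 1\<close> and there
are infinitely many points of index \<open>n\<close>, always falls under the first case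
(\<open>regular_fixed_point\<close>).
\<close>

section \<open>Rational functions in homogeneous coordinates\<close>

lemma coprime_no_common_root:
  fixes p q :: "complex poly"
  assumes "coprime p q" "poly p z = 0"
  shows "poly q z \<noteq> 0"
proof
  assume "poly q z = 0"
  with assms have "[:-z, 1:] dvd p" "[:-z, 1:] dvd q"
    by (simp_all add: poly_eq_0_iff_dvd)
  with assms(1) have "is_unit [:-z, 1:]" by (rule coprime_common_divisor)
  thus False by (simp add: is_unit_iff_degree)
qed

lemma coprime_if_no_common_root:
  fixes p q :: "complex poly"
  assumes "q \<noteq> 0" "\<And>z. poly p z = 0 \<Longrightarrow> poly q z \<noteq> 0"
  shows "coprime p q"
proof (rule coprimeI)
  fix c assume c: "c dvd p" "c dvd q"
  have "c \<noteq> 0" using c assms(1) by auto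
  have "degree c = 0"
  proof (rule ccontr)
    assume "degree c \<noteq> 0"
    then obtain z where "poly c z = 0"
      using alg_closed_imp_poly_has_root[of c] by auto
    hence "poly p z = 0" "poly q z = 0" using c by (auto elim!: dvdE)
    with assms(2) show False by blast
  qed
  with \<open>c \<noteq> 0\<close> show "is_unit c" by (simp add: is_unit_iff_degree)
qed

text \<open>
The point with homogeneous coordinates \<open>[a : b]\<close>, where \<open>a\<close> and \<open>b\<close> are not both zero. In these
coordinates poles and the point at infinity are points like all others.
\<close>

definition proj :: "complex \<Rightarrow> complex \<Rightarrow> sphere" where
  "proj a b = (if b = 0 then None else Some (a / b))"

text \<open>
The homogenisation of \<open>p\<close> to degree \<open>n\<close>, which is meant for \<open>degree p \<le> n\<close>; \<open>hom_poly\<close> below is the same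
expression with polynomials in place of the two coordinates.
\<close>

definition hom :: "complex poly \<Rightarrow> nat \<Rightarrow> complex \<Rightarrow> complex \<Rightarrow> complex" where
  "hom p n a b = (\<Sum>i\<le>n. coeff p i * a ^ i * b ^ (n - i))"

definition hom_poly :: "complex poly \<Rightarrow> nat \<Rightarrow> complex poly \<Rightarrow> complex poly \<Rightarrow> complex poly" where
  "hom_poly p n r s = (\<Sum>i\<le>n. smult (coeff p i) (r ^ i * s ^ (n - i)))"

lemma poly_hom_poly: "poly (hom_poly p n r s) z = hom p n (poly r z) (poly s z)"
  by (simp add: hom_poly_def hom_def poly_sum mult.assoc)

lemma hom_at_infinity: "hom p n a 0 = coeff p n * a ^ n"
proof -
  have "hom p n a 0 = (\<Sum>i\<le>n. if i = n then coeff p n * a ^ n else 0)"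
    unfolding hom_def by (rule sum.cong) auto
  thus ?thesis by simp
qed

lemma hom_finite:
  assumes "b \<noteq> 0" "degree p \<le> n"
  shows "hom p n a b = b ^ n * poly p (a / b)"
proof -
  have "poly p (a / b) = (\<Sum>i\<le>n. coeff p i * (a / b) ^ i)"
    unfolding poly_altdef using assms(2)
    by (intro sum.mono_neutral_left) (auto simp: coeff_eq_0)
  hence "b ^ n * poly p (a / b) = (\<Sum>i\<le>n. b ^ n * (coeff p i * (a / b) ^ i))"
    by (simp add: sum_distrib_left)
  also have "\<dots> = hom p n a b"
    unfolding hom_def using assms(1)
    by (intro sum.cong) (auto simp: power_diff field_simps)
  finally show ?thesis ..
qed

lemma hom_nonzero:
  assumes "represents p q f" "n = max (degree p) (degree q)" "a \<noteq> 0 \<or> b \<noteq> 0"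
  shows "hom p n a b \<noteq> 0 \<or> hom q n a b \<noteq> 0"
proof (cases "b = 0")
  case True
  have "q \<noteq> 0" using assms by (simp add: represents_def)
  have "coeff p n \<noteq> 0 \<or> coeff q n \<noteq> 0"
  proof (cases "degree p \<le> degree q")
    case True
    with \<open>q \<noteq> 0\<close> show ?thesis by (simp add: assms(2) max_def)
  next
    case False
    hence "p \<noteq> 0" by auto
    with False show ?thesis by (simp add: assms(2) max_def)
  qed
  with True assms(3) show ?thesis by (simp add: hom_at_infinity)
next
  case False
  have "poly p (a / b) \<noteq> 0 \<or> poly q (a / b) \<noteq> 0"
    using assms(1) coprime_no_common_root by (auto simp: represents_def)
  with False show ?thesis by (simp add: hom_finite assms(2))
qed

lemma represents_proj:
  assumes "represents p q f" "n = max (degree p) (degree q)" "a \<noteq> 0 \<or> b \<noteq> 0"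
  shows "f (proj a b) = proj (hom p n a b) (hom q n a b)"
proof (cases "b = 0")
  case True
  thus ?thesis using assms
    by (auto simp: represents_def fraction_map_def proj_def hom_at_infinity Let_def)
next
  case False
  thus ?thesis using assms
    by (auto simp: represents_def fraction_map_def proj_def hom_finite)
qed

lemma degree_hom_poly_le:
  assumes "degree r \<le> m" "degree s \<le> m"
  shows "degree (hom_poly p n r s) \<le> n * m"
  unfolding hom_poly_def
proof (rule degree_sum_le)
  fix i assume "i \<in> {..n}"
  have "degree (r ^ i * s ^ (n - i)) \<le> degree r * i + degree s * (n - i)"
    by (rule order.trans[OF degree_mult_le] add_mono degree_power_le)+
  also have "\<dots> \<le> m * i + m * (n - i)"
    using assms by (intro add_mono mult_right_mono) auto
  also have "\<dots> = n * m" using \<open>i \<in> {..n}\<close>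
    by (metis add_mult_distrib2 atMost_iff le_add_diff_inverse mult.commute)
  finally show "degree (smult (coeff p i) (r ^ i * s ^ (n - i))) \<le> n * m"
    using degree_smult_le order_trans by blast
qed auto

lemma coeff_mult_at_bounds:
  fixes p q :: "'a :: comm_semiring_0 poly"
  assumes "degree p \<le> m" "degree q \<le> n"
  shows "coeff (p * q) (m + n) = coeff p m * coeff q n"
proof -
  have "coeff (p * q) (m + n) = (\<Sum>i\<le>m + n. if i = m then coeff p m * coeff q n else 0)"
    unfolding coeff_mult
  proof (rule sum.cong)
    fix i assume "i \<in> {..m + n}"
    show "coeff p i * coeff q (m + n - i) = (if i = m then coeff p m * coeff q n else 0)"
    proof (cases "i < m")
      case True
      hence "coeff q (m + n - i) = 0" using assms(2) by (intro coeff_eq_0) linarith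
      with True show ?thesis by simp
    next
      case False
      thus ?thesis using assms(1) by (cases "i = m") (auto simp: coeff_eq_0)
    qed
  qed auto
  thus ?thesis by simp
qed

lemma coeff_power_at_bound:
  fixes p :: "'a :: comm_semiring_1 poly"
  assumes "degree p \<le> m"
  shows "coeff (p ^ n) (n * m) = coeff p m ^ n"
proof (induction n)
  case (Suc n)
  have "degree (p ^ n) \<le> n * m"
    by (rule order.trans[OF degree_power_le]) (simp add: assms mult.commute)
  thus ?case using coeff_mult_at_bounds[OF assms, of "p ^ n" "n * m"] Suc by simp
qed auto

lemma coeff_hom_poly:
  assumes "degree r \<le> m" "degree s \<le> m"
  shows "coeff (hom_poly p n r s) (n * m) = hom p n (coeff r m) (coeff s m)"
  unfolding hom_poly_def hom_def coeff_sum
proof (rule sum.cong)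
  fix i assume i: "i \<in> {..n}"
  have d: "degree (r ^ i) \<le> i * m" "degree (s ^ (n - i)) \<le> (n - i) * m"
    by (rule order.trans[OF degree_power_le]; simp add: assms mult.commute)+
  have "n * m = i * m + (n - i) * m"
    using i by (metis add_mult_distrib atMost_iff le_add_diff_inverse)
  hence "coeff (r ^ i * s ^ (n - i)) (n * m) = coeff r m ^ i * coeff s m ^ (n - i)"
    using coeff_mult_at_bounds[OF d] assms by (simp add: coeff_power_at_bound)
  thus "coeff (smult (coeff p i) (r ^ i * s ^ (n - i))) (n * m)
      = coeff p i * coeff r m ^ i * coeff s m ^ (n - i)"
    by simp
qed auto

lemma represents_finite: "represents r s g \<Longrightarrow> g (Some z) = proj (poly r z) (poly s z)"
  by (simp add: represents_def fraction_map_def proj_def)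

lemma represents_infinity:
  "represents r s g \<Longrightarrow> m = max (degree r) (degree s) \<Longrightarrow> g None = proj (coeff r m) (coeff s m)"
  by (simp add: represents_def fraction_map_def proj_def Let_def)

lemma represents_top_coeff:
  assumes "represents r s g" "m = max (degree r) (degree s)"
  shows "coeff r m \<noteq> 0 \<or> coeff s m \<noteq> 0"
  using hom_nonzero[OF assms, of 1 0] by (simp add: hom_at_infinity)

lemma represents_no_common_root:
  assumes "represents r s g"
  shows "poly r z \<noteq> 0 \<or> poly s z \<noteq> 0"
  using assms coprime_no_common_root unfolding represents_def by blast

text \<open>
Substituting \<open>r / s\<close> into \<open>p / q\<close> and clearing denominators homogeneously causes no cancellation: the
homogenisations of \<open>p\<close> and \<open>q\<close> have no common zero except the origin, and \<open>(r, s)\<close> never vanishes, neither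
at a finite point nor in its top coefficients. This gives coprimality and the product formula for
degrees at once.
\<close>

lemma represents_compose:
  assumes f: "represents p q f" and g: "represents r s g"
    and nc: "nonconstant (f \<circ> g)"
  defines "n \<equiv> max (degree p) (degree q)" and "m \<equiv> max (degree r) (degree s)"
  shows "represents (hom_poly p n r s) (hom_poly q n r s) (f \<circ> g)"
    and "max (degree (hom_poly p n r s)) (degree (hom_poly q n r s)) = n * m"
proof -
  let ?P = "hom_poly p n r s" and ?Q = "hom_poly q n r s"
  have dr: "degree r \<le> m" "degree s \<le> m" by (auto simp: m_def)
  have fin: "(f \<circ> g) (Some z) = proj (poly ?P z) (poly ?Q z)" for z
    using represents_proj[OF f n_def[THEN meta_eq_to_obj_eq] represents_no_common_root[OF g]]
    by (simp add: represents_finite[OF g] poly_hom_poly)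
  have inf: "(f \<circ> g) None = proj (coeff ?P (n * m)) (coeff ?Q (n * m))"
    using represents_proj[OF f n_def[THEN meta_eq_to_obj_eq]
        represents_top_coeff[OF g m_def[THEN meta_eq_to_obj_eq]]]
    by (simp add: represents_infinity[OF g m_def[THEN meta_eq_to_obj_eq]] coeff_hom_poly[OF dr])
  have top: "coeff ?P (n * m) \<noteq> 0 \<or> coeff ?Q (n * m) \<noteq> 0"
    using hom_nonzero[OF f n_def[THEN meta_eq_to_obj_eq]
        represents_top_coeff[OF g m_def[THEN meta_eq_to_obj_eq]]]
    by (simp add: coeff_hom_poly[OF dr])
  have le: "degree ?P \<le> n * m" "degree ?Q \<le> n * m"
    using degree_hom_poly_le[OF dr] by auto
  show max: "max (degree ?P) (degree ?Q) = n * m"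
    using top le by (meson le_antisym le_degree max.boundedI max.coboundedI1 max.coboundedI2)
  have nz: "poly ?P z \<noteq> 0 \<or> poly ?Q z \<noteq> 0" for z
    using hom_nonzero[OF f n_def[THEN meta_eq_to_obj_eq] represents_no_common_root[OF g, of z]]
    by (simp add: poly_hom_poly)
  have Q0: "?Q \<noteq> 0"
  proof
    assume Q: "?Q = 0"
    have "(f \<circ> g) x = None" for x
    proof (cases x)
      case None thus ?thesis using inf Q by (simp add: proj_def)
    next
      case (Some z) thus ?thesis using fin[of z] Q by (simp add: proj_def)
    qed
    with nc show False unfolding nonconstant_def by blast
  qed
  have cop: "coprime ?P ?Q"
    using Q0 nz by (intro coprime_if_no_common_root) auto
  have "(f \<circ> g) x = fraction_map ?P ?Q x" for x
  proof (cases x)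
    case None thus ?thesis using inf max by (simp add: fraction_map_def proj_def Let_def)
  next
    case (Some z) thus ?thesis using fin[of z] by (simp add: fraction_map_def proj_def)
  qed
  thus "represents ?P ?Q (f \<circ> g)"
    using Q0 cop unfolding represents_def by blast
qed

lemma rational_function_compose:
  assumes "rational_function f" "rational_function g" "nonconstant (f \<circ> g)"
  shows "rational_function (f \<circ> g)" "rat_degree (f \<circ> g) = rat_degree f * rat_degree g"
proof -
  obtain p q r s where *: "represents p q f" "represents r s g"
    using assms by (auto simp: rational_function_def)
  show "rational_function (f \<circ> g)"
    using represents_compose(1)[OF * assms(3)] by (auto simp: rational_function_def)
  show "rat_degree (f \<circ> g) = rat_degree f * rat_degree g"
    using represents_compose(2)[OF * assms(3)] rat_degree_eq[OF *(1)] rat_degree_eq[OF *(2)]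
      rat_degree_eq[OF represents_compose(1)[OF * assms(3)]] by simp
qed

section \<open>Local degrees\<close>

lemma param_proj: "param x u = (case x of Some c \<Rightarrow> proj (c + u) 1 | None \<Rightarrow> proj 1 u)"
  by (simp add: param_def proj_def split: option.split)

lemma param_0 [simp]: "param x 0 = x"
  by (cases x) (simp_all add: param_def)

text \<open>
In the local parameter at any point, infinity included, a rational function is again a
quotient of polynomials without common zeros. This reduces local questions to polynomials at \<open>0\<close>.
\<close>

lemma rational_function_near:
  assumes "rational_function f"
  obtains P Q where "\<And>u. poly P u \<noteq> 0 \<or> poly Q u \<noteq> 0"
    "\<And>u. f (param x u) = proj (poly P u) (poly Q u)"
proof -
  obtain p q where pq: "represents p q f" using assms by (auto simp: rational_function_def)
  show ?thesis
  proof (cases x)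
    case (Some c)
    show ?thesis
    proof (rule that[of "pcompose p [:c, 1:]" "pcompose q [:c, 1:]"])
      fix u
      show "f (param x u) = proj (poly (pcompose p [:c, 1:]) u) (poly (pcompose q [:c, 1:]) u)"
        using represents_finite[OF pq, of "c + u"] Some by (simp add: poly_pcompose param_def)
      show "poly (pcompose p [:c, 1:]) u \<noteq> 0 \<or> poly (pcompose q [:c, 1:]) u \<noteq> 0"
        using represents_no_common_root[OF pq, of "c + u"] by (simp add: poly_pcompose)
    qed
  next
    case None
    define n where "n = max (degree p) (degree q)"
    show ?thesis
    proof (rule that[of "hom_poly p n 1 [:0, 1:]" "hom_poly q n 1 [:0, 1:]"])
      fix u
      show "f (param x u) = proj (poly (hom_poly p n 1 [:0, 1:]) u) (poly (hom_poly q n 1 [:0, 1:]) u)"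
        using represents_proj[OF pq n_def, of 1 u] None by (simp add: poly_hom_poly param_proj)
    qed (use hom_nonzero[OF pq n_def] in \<open>simp add: poly_hom_poly\<close>)
  qed
qed

lemma constant_if_infinite_fibre:
  assumes "rational_function f" "infinite {z. f (Some z) = w}"
  shows "\<not> nonconstant f"
proof -
  obtain p q where pq: "represents p q f" using assms by (auto simp: rational_function_def)
  have q: "q \<noteq> 0" and cop: "coprime p q" and f: "f = fraction_map p q"
    using pq by (auto simp: represents_def)
  obtain a where a: "w = Some a"
  proof (cases w)
    case None
    have "{z. f (Some z) = w} \<subseteq> {z. poly q z = 0}"
      using None by (auto simp: represents_finite[OF pq] proj_def split: if_splits)
    thus ?thesis using assms(2) poly_roots_finite[OF q] finite_subset by blast
  qed blast
  have "{z. f (Some z) = w} \<subseteq> {z. poly (p - smult a q) z = 0}"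
    using a by (auto simp: represents_finite[OF pq] proj_def field_simps split: if_splits)
  hence "p - smult a q = 0"
    using assms(2) poly_roots_finite finite_subset by blast
  hence p: "p = smult a q" by simp
  have "poly q z \<noteq> 0" for z
    using represents_no_common_root[OF pq, of z] by (auto simp: p)
  hence "degree q = 0"
    using alg_closed_imp_poly_has_root[of q] by auto
  then obtain b where b: "q = [:b:]" by (auto elim: degree_eq_zeroE)
  have "f x = Some a" for x
    using q by (cases x) (auto simp: f p b fraction_map_def)
  thus ?thesis by (auto simp: nonconstant_def)
qed

lemma finite_fibre:
  assumes "rational_function f" "nonconstant f"
  shows "finite {x. f x = w}"
proof (rule finite_subset)
  show "{x. f x = w} \<subseteq> insert None (Some ` {z. f (Some z) = w})"
    by (auto simp: image_iff) (metis option.exhaust)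
  show "finite (insert None (Some ` {z. f (Some z) = w}))"
    using constant_if_infinite_fibre[OF assms(1)] assms(2) by blast
qed

lemma finite_vimage_rational:
  assumes "rational_function f" "nonconstant f" "finite W"
  shows "finite (f -` W)"
proof -
  have "f -` W = (\<Union>w\<in>W. {x. f x = w})" by auto
  thus ?thesis using assms finite_fibre by simp
qed

lemma inj_param: "inj (param x)"
  by (auto simp: inj_def param_def split: option.splits if_splits)

text \<open>
Read in charts at \<open>x\<close> and \<open>f x\<close>, the map \<open>f\<close> is a quotient of polynomials whose denominator does not
vanish at \<open>0\<close>, so that the local degree is an order of vanishing of a polynomial. The last
equation recovers \<open>f\<close> from its expression in charts; it fails only at zeros of \<open>D\<close>, which are the
points where the chart takes its dummy value.
\<close>

lemma local_coordinates:
  assumes "rational_function f" "nonconstant f"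
  obtains N D where "poly N 0 = 0" "poly D 0 \<noteq> 0" "N \<noteq> 0"
    "\<And>u. chart (f x) (f (param x u)) = poly N u / poly D u"
    "\<And>u. poly D u \<noteq> 0 \<Longrightarrow> f (param x u) = param (f x) (poly N u / poly D u)"
proof -
  obtain P Q where nz: "\<And>u. poly P u \<noteq> 0 \<or> poly Q u \<noteq> 0"
    and f: "\<And>u. f (param x u) = proj (poly P u) (poly Q u)"
    using rational_function_near[OF assms(1)] by metis
  have fx: "f x = proj (poly P 0) (poly Q 0)" using f[of 0] by simp
  have not_const: False if "\<And>u. f (param x u) = f x"
  proof -
    have "range (param x) \<subseteq> {y. f y = f x}" using that by auto
    moreover have "infinite (range (param x))"
      using inj_param[of x] infinite_UNIV_char_0 finite_imageD by blast
    ultimately show False using finite_fibre[OF assms] finite_subset by blast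
  qed
  show ?thesis
  proof (cases "poly Q 0 = 0")
    case True
    show ?thesis
    proof (rule that[of Q P])
      show "poly P 0 \<noteq> 0" using nz[of 0] True by simp
      show "Q \<noteq> 0" using not_const by (auto simp: f fx proj_def)
      show "chart (f x) (f (param x u)) = poly Q u / poly P u" for u
        using True by (simp add: f fx proj_def chart_def)
      show "f (param x u) = param (f x) (poly Q u / poly P u)" if "poly P u \<noteq> 0" for u
        unfolding f fx using True that by (simp add: proj_def param_def)
    qed (fact True)
  next
    case False
    define w where "w = poly P 0 / poly Q 0"
    show ?thesis
    proof (rule that[of "P - smult w Q" Q])
      show "poly (P - smult w Q) 0 = 0" using False by (simp add: w_def)
      show "P - smult w Q \<noteq> 0"
      proof
        assume "P - smult w Q = 0"
        hence P: "P = smult w Q" by simp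
        have "poly Q u \<noteq> 0" for u using nz[of u] by (auto simp: P)
        thus False using not_const by (simp add: f fx proj_def) (simp add: P)
      qed
      show "chart (f x) (f (param x u)) = poly (P - smult w Q) u / poly Q u" for u
        using False by (simp add: f fx proj_def chart_def w_def diff_divide_distrib)
      show "f (param x u) = param (f x) (poly (P - smult w Q) u / poly Q u)" if "poly Q u \<noteq> 0" for u
        unfolding f fx using False that by (simp add: proj_def param_def w_def diff_divide_distrib)
    qed (fact False)
  qed
qed

lemma zorder_poly_quotient:
  assumes "N \<noteq> 0" "poly D c \<noteq> 0"
  shows "zorder (\<lambda>u. poly N (c + u) / poly D (c + u)) 0 = int (order c N)"
proof -
  obtain r where r: "N = [:-c, 1:] ^ order c N * r" "\<not> [:-c, 1:] dvd r"
    using order_decomp[OF assms(1)] by blast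
  show ?thesis
  proof (rule zorder_eqI)
    show "open {u. poly D (c + u) \<noteq> 0}"
      by (intro open_Collect_neq continuous_intros)
    show "(\<lambda>u. poly r (c + u) / poly D (c + u)) holomorphic_on {u. poly D (c + u) \<noteq> 0}"
      by (intro holomorphic_intros) auto
    show "poly r (c + 0) / poly D (c + 0) \<noteq> 0"
      using assms(2) r(2) by (simp add: poly_eq_0_iff_dvd)
    show "poly N (c + w) / poly D (c + w)
        = poly r (c + w) / poly D (c + w) * (w - 0) powi int (order c N)" for w
      by (subst r(1)) (simp add: poly_power)
  qed (use assms in auto)
qed

lemma zorder_poly_quotient_0:
  assumes "N \<noteq> 0" "poly D 0 \<noteq> 0"
  shows "zorder (\<lambda>u. poly N u / poly D u) 0 = int (order 0 N)"
  using zorder_poly_quotient[OF assms] by simp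

lemma local_degree_pos:
  assumes "rational_function f" "nonconstant f"
  shows "local_degree f x > 0"
proof -
  obtain N D where *: "poly N 0 = 0" "poly D 0 \<noteq> 0" "N \<noteq> 0"
    "\<And>u. chart (f x) (f (param x u)) = poly N u / poly D u"
    using local_coordinates[OF assms, of x] by metis
  have "local_degree f x = order 0 N"
    unfolding local_degree_def by (simp add: *(4) zorder_poly_quotient_0[OF *(3,2)])
  thus ?thesis using order_gt_0_iff[OF *(3), of 0] *(1) by metis
qed

lemma local_degree_at_finite_value:
  assumes "represents p q f" "nonconstant f" "f (Some c) = Some w"
  shows "p - smult w q \<noteq> 0" "local_degree f (Some c) = order c (p - smult w q)"
proof -
  have q: "poly q c \<noteq> 0" and w: "w = poly p c / poly q c"
    using assms(3) by (auto simp: represents_finite[OF assms(1)] proj_def split: if_splits)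
  show nz: "p - smult w q \<noteq> 0"
  proof
    assume "p - smult w q = 0"
    hence p: "p = smult w q" by simp
    have "poly q z \<noteq> 0" for z using represents_no_common_root[OF assms(1), of z] by (auto simp: p)
    hence "UNIV \<subseteq> {z. f (Some z) = Some w}"
      by (auto simp: represents_finite[OF assms(1)] proj_def) (simp add: p)
    moreover have "rational_function f" using assms(1) by (auto simp: rational_function_def)
    ultimately show False
      using constant_if_infinite_fibre[of f "Some w"] assms(2) infinite_UNIV_char_0[where 'a = complex]
        finite_subset by blast
  qed
  have "chart (f (Some c)) (f (param (Some c) u)) = poly (p - smult w q) (c + u) / poly q (c + u)" for u
    unfolding assms(3) using q
    by (simp add: chart_def param_def represents_finite[OF assms(1)] proj_def diff_divide_distrib)
  thus "local_degree f (Some c) = order c (p - smult w q)"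
    unfolding local_degree_def using zorder_poly_quotient[OF nz q] by simp
qed

lemma local_degree_at_pole:
  assumes "represents p q f" "f (Some c) = None"
  shows "local_degree f (Some c) = order c q"
proof -
  have q: "poly q c = 0"
    using assms(2) by (auto simp: represents_finite[OF assms(1)] proj_def split: if_splits)
  hence p: "poly p c \<noteq> 0" using represents_no_common_root[OF assms(1), of c] by simp
  have "chart (f (Some c)) (f (param (Some c) u)) = poly q (c + u) / poly p (c + u)" for u
    unfolding assms(2)
    by (simp add: chart_def param_def represents_finite[OF assms(1)] proj_def)
  thus ?thesis
    unfolding local_degree_def using zorder_poly_quotient[OF _ p, of q] assms(1)
    by (simp add: represents_def)
qed

text \<open>
At infinity the order of vanishing of \<open>p / q\<close> is the difference of the degrees.
\<close>

lemma local_degree_at_infinity: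
  assumes "represents p q f" "nonconstant f" "f None = Some 0"
  shows "p \<noteq> 0" "degree q = degree p + local_degree f None"
proof -
  have q: "q \<noteq> 0" using assms(1) by (simp add: represents_def)
  show p: "p \<noteq> 0"
  proof
    assume p: "p = 0"
    have "poly q z \<noteq> 0" for z using represents_no_common_root[OF assms(1), of z] by (auto simp: p)
    hence "f x = Some 0" for x
      using assms(3) by (cases x) (auto simp: represents_finite[OF assms(1)] proj_def p)
    thus False using assms(2) by (auto simp: nonconstant_def)
  qed
  have deg: "degree p < degree q"
  proof (rule ccontr)
    assume "\<not> degree p < degree q"
    hence "max (degree p) (degree q) = degree p" by simp
    thus False using represents_infinity[OF assms(1) refl] assms(3) p
      by (auto simp: proj_def split: if_splits)
  qed
  let ?p = "reflect_poly p" and ?q = "reflect_poly q"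
  have "zorder (\<lambda>u. chart (f None) (f (param None u))) 0 = int (degree q - degree p)"
  proof (rule zorder_eqI)
    show "open {u. poly ?q u \<noteq> 0}"
      by (intro open_Collect_neq continuous_intros)
    show "(\<lambda>u. poly ?p u / poly ?q u) holomorphic_on {u. poly ?q u \<noteq> 0}"
      by (intro holomorphic_intros) auto
    show "poly ?p 0 / poly ?q 0 \<noteq> 0" "0 \<in> {u. poly ?q u \<noteq> 0}" using p q by auto
    show "chart (f None) (f (param None w))
        = poly ?p w / poly ?q w * (w - 0) powi int (degree q - degree p)"
      if "w \<in> {u. poly ?q u \<noteq> 0}" "w \<noteq> 0" for w
    proof -
      have "poly q (1 / w) \<noteq> 0"
        using that by (simp add: poly_reflect_poly_nz inverse_eq_divide)
      moreover obtain k where k: "degree q = degree p + k"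
        using that[of "degree q - degree p"] deg by simp
      ultimately show ?thesis using that
        by (simp add: assms(3) chart_def param_def represents_finite[OF assms(1)] proj_def
            poly_reflect_poly_nz inverse_eq_divide power_add)
    qed
  qed
  thus "degree q = degree p + local_degree f None"
    using deg by (simp add: local_degree_def)
qed

text \<open>
Near \<open>0\<close> the expression of \<open>f \<circ> g\<close> in charts is the composite of the expressions of \<open>f\<close> and \<open>g\<close>, and
orders of vanishing multiply under composition.
\<close>

lemma local_degree_compose:
  assumes f: "rational_function f" "nonconstant f" and g: "rational_function g" "nonconstant g"
  shows "local_degree (f \<circ> g) x = local_degree f (g x) * local_degree g x"
proof -
  obtain N D where F: "poly N 0 = 0" "poly D 0 \<noteq> 0" "N \<noteq> 0"
    "\<And>u. chart (f (g x)) (f (param (g x) u)) = poly N u / poly D u"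
    using local_coordinates[OF f, of "g x"] by metis
  obtain N' D' where G: "poly N' 0 = 0" "poly D' 0 \<noteq> 0" "N' \<noteq> 0"
    "\<And>u. chart (g x) (g (param x u)) = poly N' u / poly D' u"
    "\<And>u. poly D' u \<noteq> 0 \<Longrightarrow> g (param x u) = param (g x) (poly N' u / poly D' u)"
    using local_coordinates[OF g, of x] by metis
  define F where "F = (\<lambda>u. poly N u / poly D u)"
  define G where "G = (\<lambda>u. poly N' u / poly D' u)"
  have near: "eventually (\<lambda>u. poly p u \<noteq> 0) (at 0)" if "p \<noteq> 0" for p :: "complex poly"
    using islimpt_finite[OF poly_roots_finite[OF that], of 0]
    by (simp add: islimpt_iff_eventually frequently_def)
  have nz: "D \<noteq> 0" "D' \<noteq> 0" using F(2) G(2) by auto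
  have "eventually (\<lambda>u. chart ((f \<circ> g) x) ((f \<circ> g) (param x u)) = (F \<circ> G) u) (at 0)"
    using near[OF nz(2)] by eventually_elim (simp add: G(5) F(4) F_def G_def)
  hence "zorder (\<lambda>u. chart ((f \<circ> g) x) ((f \<circ> g) (param x u))) 0 = zorder (F \<circ> G) 0"
    by (intro zorder_cong) auto
  also have "\<dots> = zorder F (G 0) * zorder (\<lambda>u. G u - G 0) 0"
  proof (rule zorder_compose')
    have "poly p analytic_on {0}" for p :: "complex poly"
      by (rule analytic_on_subset[of _ UNIV]) (auto simp: analytic_on_open intro!: holomorphic_intros)
    hence an: "F analytic_on {0}" "G analytic_on {0}"
      unfolding F_def G_def using F(2) G(2) by (auto intro!: analytic_intros)
    have G0: "G 0 = 0" by (simp add: G_def G(1))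
    show "isolated_singularity_at F (G 0)" "not_essential F (G 0)" "G analytic_on {0}"
      using an by (auto simp: G0 intro: isolated_singularity_at_analytic not_essential_analytic)
    show "eventually (\<lambda>u. F u \<noteq> 0) (at (G 0))"
      unfolding G0 using near[OF F(3)] near[OF nz(1)] by eventually_elim (simp add: F_def)
    show "eventually (\<lambda>u. G u \<noteq> G 0) (at 0)"
      unfolding G0 using near[OF G(3)] near[OF nz(2)] by eventually_elim (simp add: G_def)
  qed
  also have "\<dots> = int (order 0 N) * int (order 0 N')"
    using zorder_poly_quotient_0[OF F(3,2)] zorder_poly_quotient_0[OF G(3,2)]
    by (simp add: F_def G_def G(1))
  finally show ?thesis
    unfolding local_degree_def
    by (simp add: F(4) G(4) zorder_poly_quotient_0[OF F(3,2)] zorder_poly_quotient_0[OF G(3,2)]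
        nat_mult_distrib)
qed

lemma local_degree_id: "local_degree id x = 1"
proof -
  have "eventually (\<lambda>u. chart x (param x u) = u) (at 0)"
    by (cases x) (auto simp: chart_def param_def)
  hence "zorder (\<lambda>u. chart x (param x u)) 0 = zorder (\<lambda>u. u) (0 :: complex)"
    by (intro zorder_cong) auto
  also have "\<dots> = 1"
    using zorder_poly_quotient_0[of "[:0, 1:]" 1] order_power_n_n[of 0 1] by simp
  finally show ?thesis by (simp add: local_degree_def)
qed

section \<open>Moebius transformations and coverings\<close>

text \<open>
The preimages of \<open>w\<close> are the zeros of a form of degree \<open>n \<ge> 1\<close> in two variables: either it has a
zero in the affine part or its top coefficient vanishes, and then infinity is a zero.
\<close>

lemma rational_surj:
  assumes "rational_function f" "nonconstant f"
  shows "\<exists>x. f x = w"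
proof -
  obtain p q where pq: "represents p q f" using assms by (auto simp: rational_function_def)
  define n where "n = max (degree p) (degree q)"
  have f: "f (proj a b) = proj (hom p n a b) (hom q n a b)" if "a \<noteq> 0 \<or> b \<noteq> 0" for a b
    using represents_proj[OF pq n_def that] .
  have *: "\<exists>x. f x = w" if h: "degree h \<le> n" "\<And>a b. hom h n a b = 0 \<Longrightarrow> a \<noteq> 0 \<or> b \<noteq> 0
      \<Longrightarrow> f (proj a b) = w" for h
  proof (cases "degree h = n")
    case True
    show ?thesis
    proof (cases "n = 0")
      case True
      have "degree p = 0" "degree q = 0" using True by (auto simp: n_def)
      then obtain c d where "p = [:c:]" "q = [:d:]" by (metis degree_eq_zeroE)
      hence "f x = proj c d" for x
        using pq by (cases x) (auto simp: represents_def fraction_map_def proj_def)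
      thus ?thesis using assms(2) by (auto simp: nonconstant_def)
    next
      case False
      then obtain z where "poly h z = 0" using \<open>degree h = n\<close> alg_closed_imp_poly_has_root[of h] by auto
      hence "hom h n z 1 = 0" using h(1) by (simp add: hom_finite)
      thus ?thesis using h(2)[of z 1] by auto
    qed
  next
    case False
    hence "coeff h n = 0" using h(1) by (simp add: coeff_eq_0)
    hence "hom h n 1 0 = 0" by (simp add: hom_at_infinity)
    thus ?thesis using h(2)[of 1 0] by auto
  qed
  show ?thesis
  proof (cases w)
    case None
    show ?thesis
      by (rule *[of q]) (auto simp: n_def f[unfolded n_def] None proj_def[of "hom _ _ _ _"])
  next
    case (Some c)
    show ?thesis
    proof (rule *[of "p - smult c q"])
      show "degree (p - smult c q) \<le> n"
        unfolding n_def by (meson degree_diff_le_max degree_smult_le max.mono order.refl order.trans)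
      fix a b :: complex assume h: "hom (p - smult c q) n a b = 0" "a \<noteq> 0 \<or> b \<noteq> 0"
      have "hom (p - smult c q) n a b = hom p n a b - c * hom q n a b"
        by (simp add: hom_def sum_distrib_left sum_subtractf algebra_simps)
      hence eq: "hom p n a b = c * hom q n a b" using h by simp
      moreover have "hom q n a b \<noteq> 0" using hom_nonzero[OF pq n_def h(2)] eq by auto
      ultimately show "f (proj a b) = w" by (simp add: f[OF h(2)] proj_def[of "_ * _"] Some)
    qed
  qed
qed

lemma nonconstant_compose:
  assumes "nonconstant f" "rational_function g" "nonconstant g"
  shows "nonconstant (f \<circ> g)"
  using assms(1) rational_surj[OF assms(2,3)] unfolding nonconstant_def by (metis comp_apply)

lemma represents_id: "represents [:0, 1:] 1 id"
proof -
  have "id x = fraction_map [:0, 1:] 1 x" for x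
    by (cases x) (auto simp: fraction_map_def)
  thus ?thesis by (auto simp: represents_def)
qed

lemma nonconstant_id: "nonconstant id"
  by (auto simp: nonconstant_def) (metis option.distinct(1))

lemma nonconstant_if_invertible:
  assumes "Y \<circ> X = id"
  shows "nonconstant X"
  unfolding nonconstant_def
proof
  assume "\<exists>c. \<forall>x. X x = c"
  then obtain c where "\<And>x. X x = c" by blast
  hence "Y c = x" for x using fun_cong[OF assms, of x] by simp
  from this[of None] this[of "Some 0"] show False by simp
qed

lemma invertible_rationalE:
  assumes "invertible_rational m"
  obtains m' where "invertible_rational m'" "m \<circ> m' = id" "m' \<circ> m = id"
  using assms unfolding invertible_rational_def by metis

lemma invertible_rational_nonconstant: "invertible_rational m \<Longrightarrow> nonconstant m"
  using nonconstant_if_invertible unfolding invertible_rational_def by blast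

lemma invertible_rational_id: "invertible_rational id"
  using represents_id by (auto simp: invertible_rational_def rational_function_def)

lemma invertible_rational_compose:
  assumes "invertible_rational f" "invertible_rational g"
  shows "invertible_rational (f \<circ> g)"
proof -
  obtain f' g' where inv: "rational_function f'" "f \<circ> f' = id" "f' \<circ> f = id"
    "rational_function g'" "g \<circ> g' = id" "g' \<circ> g = id"
    using assms unfolding invertible_rational_def by blast
  have "(f \<circ> g) \<circ> (g' \<circ> f') = id" "(g' \<circ> f') \<circ> (f \<circ> g) = id"
    using inv by (metis comp_assoc comp_id)+
  moreover have "rational_function (f \<circ> g)" "rational_function (g' \<circ> f')"
    using nonconstant_if_invertible calculation assms inv rational_function_compose(1)
    by (metis invertible_rational_def)+
  ultimately show ?thesis unfolding invertible_rational_def by blast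
qed

lemma local_degree_invertible:
  assumes "invertible_rational m"
  shows "local_degree m x = 1"
proof -
  obtain m' where m': "invertible_rational m'" "m' \<circ> m = id"
    using assms by (rule invertible_rationalE)
  have "local_degree (m' \<circ> m) x = local_degree m' (m x) * local_degree m x"
    using assms m' by (intro local_degree_compose invertible_rational_nonconstant)
      (auto simp: invertible_rational_def)
  thus ?thesis by (simp add: m' local_degree_id)
qed

lemma rat_degree_invertible:
  assumes "invertible_rational m"
  shows "rat_degree m = 1"
proof -
  obtain m' where m': "invertible_rational m'" "m' \<circ> m = id"
    using assms by (rule invertible_rationalE)
  have "rat_degree (m' \<circ> m) = rat_degree m' * rat_degree m"
    using assms m' nonconstant_id by (intro rational_function_compose)
      (auto simp: invertible_rational_def)
  moreover have "rat_degree id = 1" using rat_degree_eq[OF represents_id] by simp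
  ultimately show ?thesis by (simp add: m')
qed

text \<open>
Everything that matters for coverings is invariant under Moebius changes of coordinates. This is
used to move inconvenient points away from infinity.
\<close>

lemma moebius_conjugate:
  assumes "invertible_rational m" "invertible_rational m'"
    and "rational_function f" "nonconstant f"
  shows "rational_function (m \<circ> f \<circ> m')" "nonconstant (m \<circ> f \<circ> m')"
    and "rat_degree (m \<circ> f \<circ> m') = rat_degree f"
    and "local_degree (m \<circ> f \<circ> m') x = local_degree f (m' x)"
proof -
  have m: "rational_function m" "nonconstant m" "rational_function m'" "nonconstant m'"
    using assms invertible_rational_nonconstant by (auto simp: invertible_rational_def)
  have mf: "nonconstant (m \<circ> f)" "rational_function (m \<circ> f)"
    using nonconstant_compose rational_function_compose(1) m assms(3,4) by blast+
  show nc: "nonconstant (m \<circ> f \<circ> m')" by (rule nonconstant_compose[OF mf(1) m(3,4)])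
  show "rational_function (m \<circ> f \<circ> m')" by (rule rational_function_compose(1)[OF mf(2) m(3) nc])
  show "rat_degree (m \<circ> f \<circ> m') = rat_degree f"
    using rational_function_compose(2)[OF mf(2) m(3) nc]
      rational_function_compose(2)[OF m(1) assms(3) mf(1)] rat_degree_invertible assms by simp
  show "local_degree (m \<circ> f \<circ> m') x = local_degree f (m' x)"
    using local_degree_compose[OF mf(2,1) m(3,4)] local_degree_compose[OF m(1,2) assms(3,4)]
      local_degree_invertible assms(1,2) by simp
qed

lemma invertible_rational_affine:
  assumes "a \<noteq> 0"
  shows "invertible_rational (map_option (\<lambda>z. a * z + b))"
proof -
  have "rational_function (map_option (\<lambda>z. a * z + b))" if "a \<noteq> 0" for a b :: complex
  proof -
    have "map_option (\<lambda>z. a * z + b) x = fraction_map [:b, a:] 1 x" for x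
      using that by (cases x) (auto simp: fraction_map_def algebra_simps)
    hence "represents [:b, a:] 1 (map_option (\<lambda>z. a * z + b))"
      by (auto simp: represents_def)
    thus ?thesis by (auto simp: rational_function_def)
  qed
  note this[OF assms, of b] this[of "1 / a" "- b / a"]
  moreover have "map_option (\<lambda>z. a * z + b) \<circ> map_option (\<lambda>z. 1 / a * z + - b / a) = id"
    "map_option (\<lambda>z. 1 / a * z + - b / a) \<circ> map_option (\<lambda>z. a * z + b) = id"
    using assms by (auto simp: fun_eq_iff option.map_comp o_def field_simps option.map_ident)
  ultimately show ?thesis
    using assms unfolding invertible_rational_def by auto
qed

lemma invertible_rational_inversion:
  "invertible_rational (\<lambda>x. case x of None \<Rightarrow> Some 0 | Some z \<Rightarrow> if z = 0 then None else Some (1 / z))"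
  (is "invertible_rational ?i")
proof -
  have "?i x = fraction_map 1 [:0, 1:] x" for x
    by (cases x) (auto simp: fraction_map_def)
  moreover have "coprime 1 ([:0, 1:] :: complex poly)" by simp
  ultimately have "represents 1 [:0, 1:] ?i"
    by (auto simp: represents_def)
  hence "rational_function ?i" by (auto simp: rational_function_def)
  moreover have "?i \<circ> ?i = id" by (auto simp: fun_eq_iff split: option.split)
  ultimately show ?thesis unfolding invertible_rational_def by blast
qed

lemma moebius_to_standard:
  assumes "distinct [p, q, r]"
  shows "\<exists>m. invertible_rational m \<and> m p = None \<and> m q = Some 0 \<and> m r = Some 1"
proof -
  define i :: "sphere \<Rightarrow> sphere" where
    "i = (\<lambda>x. case x of None \<Rightarrow> Some 0 | Some z \<Rightarrow> if z = 0 then None else Some (1 / z))"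
  have "\<exists>m. invertible_rational m \<and> m p = None"
  proof (cases p)
    case None thus ?thesis using invertible_rational_id by auto
  next
    case (Some a)
    have "invertible_rational (i \<circ> map_option (\<lambda>z. 1 * z + - a))"
      unfolding i_def
      by (intro invertible_rational_compose invertible_rational_inversion invertible_rational_affine) simp
    moreover have "(i \<circ> map_option (\<lambda>z. 1 * z + - a)) p = None"
      by (simp add: Some i_def)
    ultimately show ?thesis by blast
  qed
  then obtain m where m: "invertible_rational m" "m p = None" by blast
  have inj: "inj m" using m(1) by (metis invertible_rationalE inj_on_id inj_on_imageI2)
  have "m q \<noteq> None" "m r \<noteq> None" "m q \<noteq> m r"
    using assms m(2) injD[OF inj] by (metis distinct_length_2_or_more)+
  then obtain b c where bc: "m q = Some b" "m r = Some c" "b \<noteq> c" by auto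
  let ?h = "map_option (\<lambda>z. 1 / (c - b) * z + - b / (c - b))"
  have "invertible_rational (?h \<circ> m)"
    using bc m by (intro invertible_rational_compose invertible_rational_affine) auto
  moreover have "(?h \<circ> m) p = None" "(?h \<circ> m) q = Some 0" "(?h \<circ> m) r = Some 1"
    using bc m by (simp_all flip: diff_divide_distrib)
  ultimately show ?thesis by blast
qed

lemma moebius_triple:
  assumes "distinct [p, q, r]" "distinct [p', q', r']"
  shows "\<exists>m. invertible_rational m \<and> m p = p' \<and> m q = q' \<and> m r = r'"
proof -
  obtain f where f: "invertible_rational f" "f p = None" "f q = Some 0" "f r = Some 1"
    using moebius_to_standard[OF assms(1)] by blast
  obtain g where g: "invertible_rational g" "g p' = None" "g q' = Some 0" "g r' = Some 1"
    using moebius_to_standard[OF assms(2)] by blast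
  obtain h where h: "invertible_rational h" "h \<circ> g = id"
    using g(1) by (rule invertible_rationalE)
  have "(h \<circ> f) p = p'" "(h \<circ> f) q = q'" "(h \<circ> f) r = r'"
    using f g h(2) by (metis comp_apply id_apply)+
  thus ?thesis using invertible_rational_compose[OF h(1) f(1)] by blast
qed

lemma orbifold_covering_compose:
  assumes "orbifold_covering f \<nu>1 \<nu>2" "orbifold_covering g \<nu>2 \<nu>3"
  shows "orbifold_covering (g \<circ> f) \<nu>1 \<nu>3"
proof -
  have fg: "rational_function f" "nonconstant f" "rational_function g" "nonconstant g"
    using assms by (auto simp: orbifold_covering_def)
  have "nonconstant (g \<circ> f)" using nonconstant_compose fg by blast
  moreover have "rational_function (g \<circ> f)" using rational_function_compose(1) fg calculation by blast
  moreover have "\<nu>3 ((g \<circ> f) z) = \<nu>1 z * enat (local_degree (g \<circ> f) z)" for z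
  proof -
    have "\<nu>3 (g (f z)) = \<nu>1 z * enat (local_degree f z) * enat (local_degree g (f z))"
      using assms by (simp add: orbifold_covering_def)
    also have "\<dots> = \<nu>1 z * enat (local_degree g (f z) * local_degree f z)"
      by (simp add: ac_simps flip: times_enat_simps(1))
    finally show ?thesis using local_degree_compose fg by simp
  qed
  ultimately show ?thesis by (simp add: orbifold_covering_def)
qed

lemma orbifold_covering_invertible:
  assumes "invertible_rational m" "\<And>z. \<nu>2 (m z) = \<nu>1 z"
  shows "orbifold_covering m \<nu>1 \<nu>2"
proof -
  have "rational_function m" using assms(1) by (simp add: invertible_rational_def)
  moreover have "enat (Suc 0) = 1" by (simp add: one_enat_def)
  ultimately show ?thesis
    using assms invertible_rational_nonconstant
    by (simp add: orbifold_covering_def local_degree_invertible)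
qed

section \<open>The invariant form\<close>

text \<open>
The numerator of the derivative of \<open>p / q\<close> over the denominator \<open>q\<^sup>2\<close>. It is unchanged when a multiple of
\<open>q\<close> is added to \<open>p\<close>, and changes its sign when \<open>p\<close> and \<open>q\<close> are exchanged, so it measures
ramification at poles and at all finite values alike.
\<close>

definition wronskian :: "complex poly \<Rightarrow> complex poly \<Rightarrow> complex poly" where
  "wronskian p q = pderiv p * q - p * pderiv q"

lemma order_wronskian:
  assumes "h \<noteq> 0" "poly h c = 0" "poly q c \<noteq> 0"
  shows "wronskian h q \<noteq> 0" "order c h = Suc (order c (wronskian h q))"
proof -
  obtain r where r: "h = [:-c, 1:] ^ order c h * r" "\<not> [:-c, 1:] dvd r"
    using order_decomp[OF assms(1)] by blast
  obtain l where l: "order c h = Suc l"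
    using order_gt_0_iff[OF assms(1), of c] assms(2) gr0_implies_Suc by blast
  \<comment> \<open>The Wronskian of \<open>h\<close> and \<open>q\<close> divided by \<open>(z - c)\<^sup>l\<close>, with \<open>h = (z - c)\<^sup>l\<^sup>+\<^sup>1 r\<close>.\<close>
  define t where "t = smult (of_nat (Suc l)) (r * q) + [:-c, 1:] * (pderiv r * q - r * pderiv q)"
  have h: "h = [:-c, 1:] ^ Suc l * r" using r(1) l by metis
  have W: "wronskian h q = [:-c, 1:] ^ l * t"
    unfolding wronskian_def h lemma_order_pderiv1 t_def
    by (simp add: algebra_simps del: of_nat_Suc)
  have rc: "poly r c \<noteq> 0" using r(2) by (simp add: poly_eq_0_iff_dvd)
  have t: "poly t c \<noteq> 0"
    using rc assms(3) by (simp add: t_def del: of_nat_Suc)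
  hence "t \<noteq> 0" by auto
  thus nz: "wronskian h q \<noteq> 0" by (simp add: W)
  have "order c (wronskian h q) = order c ([:-c, 1:] ^ l) + order c t"
    using nz unfolding W by (rule order_mult)
  thus "order c h = Suc (order c (wronskian h q))"
    using t by (simp add: l order_power_n_n order_0I)
qed

lemma wronskian_local_degree:
  assumes "represents p q f" "nonconstant f"
  shows "wronskian p q \<noteq> 0" "local_degree f (Some c) = Suc (order c (wronskian p q))"
proof -
  have *: "wronskian p q \<noteq> 0 \<and> local_degree f (Some c) = Suc (order c (wronskian p q))"
  proof (cases "f (Some c)")
    case None
    hence c: "poly q c = 0"
      by (auto simp: represents_finite[OF assms(1)] proj_def split: if_splits)
    have "wronskian p q = - wronskian q p" by (simp add: wronskian_def)
    moreover have "q \<noteq> 0" using assms(1) by (simp add: represents_def)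
    ultimately show ?thesis
      using order_wronskian[of q c p] c represents_no_common_root[OF assms(1), of c]
        local_degree_at_pole[OF assms(1) None] by auto
  next
    case (Some w)
    have q: "poly q c \<noteq> 0" and w: "poly (p - smult w q) c = 0"
      using Some by (auto simp: represents_finite[OF assms(1)] proj_def split: if_splits)
    have "wronskian (p - smult w q) q = wronskian p q"
      by (simp add: wronskian_def pderiv_diff pderiv_smult algebra_simps)
    thus ?thesis
      using order_wronskian[OF local_degree_at_finite_value(1)[OF assms Some] w q]
        local_degree_at_finite_value(2)[OF assms Some] by simp
  qed
  show "wronskian p q \<noteq> 0" "local_degree f (Some c) = Suc (order c (wronskian p q))"
    using * by auto
qed

lemma order_prod_power:
  assumes "finite S" "\<And>s. s \<in> S \<Longrightarrow> g s \<noteq> 0"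
  shows "order c (\<Prod>s\<in>S. g s ^ k s) = (\<Sum>s\<in>S. k s * order c (g s))"
proof -
  have pw: "order c (g s ^ m) = m * order c (g s)" if "g s \<noteq> 0" for s m
    using that by (induction m) (simp_all add: order_mult)
  from assms show ?thesis
  proof (induction S rule: finite_induct)
    case (insert s S)
    hence "g s ^ k s * (\<Prod>s\<in>S. g s ^ k s) \<noteq> 0" by simp
    thus ?case using insert by (simp add: order_mult pw)
  qed simp
qed

lemma proportional_if_same_orders:
  fixes p q :: "complex poly"
  assumes "p \<noteq> 0" "q \<noteq> 0" "\<And>c. order c p = order c q"
  shows "\<exists>a. a \<noteq> 0 \<and> p = smult a q"
proof -
  have "proots p = proots q" using assms by (intro multiset_eqI) simp
  hence "p = smult (lead_coeff p) (\<Prod>x\<in>#proots q. [:-x, 1:])"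
    using complex_poly_decompose_multiset[of p] by simp
  also have "\<dots> = smult (lead_coeff p / lead_coeff q) (smult (lead_coeff q) (\<Prod>x\<in>#proots q. [:-x, 1:]))"
    using assms(2) by simp
  finally show ?thesis
    using assms by (intro exI[of _ "lead_coeff p / lead_coeff q"])
      (simp add: complex_poly_decompose_multiset)
qed

text \<open>
A weight \<open>j\<close> stands for \<open>n / \<nu>\<close>, where \<open>n\<close> is a common multiple of the finite values of \<open>\<nu>\<close> and
\<open>n / \<infinity> = 0\<close>. In terms of \<open>j\<close> the covering condition is an equation between natural numbers, in which
infinite indices need no special treatment.
\<close>

definition weight :: "nat \<Rightarrow> (sphere \<Rightarrow> nat) \<Rightarrow> bool" where
  "weight n j \<longleftrightarrow> n > 0 \<and> (\<forall>z. j z \<le> n) \<and> finite {z. j z \<noteq> n}"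

definition weight_covering :: "(sphere \<Rightarrow> nat) \<Rightarrow> (sphere \<Rightarrow> sphere) \<Rightarrow> bool" where
  "weight_covering j f \<longleftrightarrow>
     rational_function f \<and> nonconstant f \<and> (\<forall>z. j z = local_degree f z * j (f z))"

lemma weight_coveringD:
  assumes "weight_covering j f"
  shows "rational_function f" "nonconstant f" "j z = local_degree f z * j (f z)"
  using assms unfolding weight_covering_def by blast+

definition cone_points :: "nat \<Rightarrow> (sphere \<Rightarrow> nat) \<Rightarrow> complex set" where
  "cone_points n j = {s. j (Some s) \<noteq> n}"

lemma finite_cone_points: "weight n j \<Longrightarrow> finite (cone_points n j)"
  using finite_vimageI[of "{z. j z \<noteq> n}" Some]
  by (auto simp: weight_def cone_points_def vimage_def)

text \<open>
The form \<open>dz\<^sup>n / T(z)\<close> with this polynomial \<open>T\<close> has order \<open>j z - n\<close> at every finite \<open>z\<close>. If the exponents of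
\<open>T\<close> add up to \<open>2 n\<close>, it has order \<open>0\<close> at infinity; then it is, up to a constant, the form which
becomes \<open>dz\<^sup>n\<close> on the universal covering of a Euclidean orbifold with weight \<open>j\<close> and no exceptional point
at infinity.
\<close>

definition cone_poly :: "nat \<Rightarrow> (sphere \<Rightarrow> nat) \<Rightarrow> complex poly" where
  "cone_poly n j = (\<Prod>s\<in>cone_points n j. [:-s, 1:] ^ (n - j (Some s)))"

lemma order_cone_poly:
  assumes "weight n j"
  shows "order c (cone_poly n j) = n - j (Some c)"
proof -
  let ?S = "cone_points n j" and ?k = "\<lambda>s. n - j (Some s)"
  note fin = finite_cone_points[OF assms]
  have o1: "order c [:-s, 1:] = (if s = c then 1 else 0)" for s
    using order_power_n_n[of c 1] by (auto intro: order_0I)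
  have "order c (cone_poly n j) = (\<Sum>s\<in>?S. ?k s * order c [:-s, 1:])"
    unfolding cone_poly_def by (rule order_prod_power[OF fin]) simp
  also have "\<dots> = (\<Sum>s\<in>?S. if s = c then ?k c else 0)"
    by (intro sum.cong) (auto simp: o1)
  also have "\<dots> = ?k c"
    using fin by (auto simp: cone_points_def)
  finally show ?thesis .
qed

text \<open>
Over a point that is not exceptional a covering is unramified.
\<close>

lemma weight_covering_at_full_value:
  assumes "weight n j" "weight_covering j f" "j (f z) = n"
  shows "j z = n" "local_degree f z = 1"
proof -
  have *: "local_degree f z > 0" "j z = local_degree f z * n" "j z \<le> n" "n > 0"
    using assms(1) weight_coveringD[OF assms(2)] local_degree_pos[of f z]
    unfolding weight_def assms(3)[symmetric] by blast+
  hence "local_degree f z * n \<le> 1 * n" by simp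
  hence "local_degree f z \<le> 1" using *(4) by (metis mult_le_cancel2)
  thus "local_degree f z = 1" "j z = n" using * by auto
qed

text \<open>
This says, without denominators, that the pullback of \<open>dz\<^sup>n / T(z)\<close> under \<open>f = p / q\<close> is a constant
multiple of the form itself. Both sides are polynomials, and their orders agree at every finite point
\<open>c\<close>: with \<open>d\<close> the local degree this is \<open>n (d - 1) + (n - j c) = d (n - j (f c))\<close>, that is, the
covering condition. At poles of \<open>f\<close> both orders vanish, because infinity is not exceptional.
\<close>

lemma wronskian_identity:
  assumes j: "weight n j" "j None = n" and f: "weight_covering j f" "represents p q f"
  shows "\<exists>a. a \<noteq> 0 \<and> wronskian p q ^ n * cone_poly n j
    = smult a (\<Prod>s\<in>cone_points n j. (p - smult s q) ^ (n - j (Some s)))"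
proof (rule proportional_if_same_orders)
  let ?S = "cone_points n j" and ?k = "\<lambda>s. n - j (Some s)"
  have nc: "nonconstant f" using f(1) by (rule weight_coveringD)
  note fin = finite_cone_points[OF j(1)]
  have T: "cone_poly n j \<noteq> 0"
    using fin by (simp add: cone_poly_def)
  have nz: "p - smult s q \<noteq> 0" for s
  proof -
    obtain x where x: "f x = Some s"
      using rational_surj weight_coveringD(1,2)[OF f(1)] by blast
    show ?thesis
    proof
      assume "p - smult s q = 0"
      hence p: "p = smult s q" by simp
      have "poly q 0 \<noteq> 0" using represents_no_common_root[OF f(2), of 0] by (auto simp: p)
      hence "f (Some 0) = Some s"
        unfolding represents_finite[OF f(2)] proj_def by (simp add: p)
      from local_degree_at_finite_value(1)[OF f(2) nc this] show False by (simp add: p)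
    qed
  qed
  show "wronskian p q ^ n * cone_poly n j \<noteq> 0"
    using wronskian_local_degree(1)[OF f(2) nc] T by simp
  show "(\<Prod>s\<in>?S. (p - smult s q) ^ ?k s) \<noteq> 0"
    using fin nz by simp
  fix c :: complex
  have L: "order c (cone_poly n j) = ?k c" by (rule order_cone_poly[OF j(1)])
  have ow: "order c (wronskian p q ^ n) = n * order c (wronskian p q)"
    using order_prod_power[of "{0::nat}" "\<lambda>_. wronskian p q" c "\<lambda>_. n"]
      wronskian_local_degree(1)[OF f(2) nc] by simp
  have o2: "order c (p - smult s q)
      = (if f (Some c) = Some s then local_degree f (Some c) else 0)" for s
  proof (cases "f (Some c) = Some s")
    case True
    thus ?thesis using local_degree_at_finite_value(2)[OF f(2) nc] by simp
  next
    case False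
    have "poly (p - smult s q) c \<noteq> 0"
      using False represents_no_common_root[OF f(2), of c]
      by (auto simp: represents_finite[OF f(2)] proj_def split: if_splits)
    with False show ?thesis by (simp add: order_0I)
  qed
  have "order c (\<Prod>s\<in>?S. (p - smult s q) ^ ?k s) = (\<Sum>s\<in>?S. ?k s * order c (p - smult s q))"
    by (rule order_prod_power[OF fin nz])
  also have "\<dots> = (n - j (f (Some c))) * local_degree f (Some c)"
  proof (cases "f (Some c)")
    case None
    thus ?thesis by (simp add: o2 j(2))
  next
    case (Some w)
    have "(\<Sum>s\<in>?S. ?k s * order c (p - smult s q))
        = (\<Sum>s\<in>?S. if s = w then ?k w * local_degree f (Some c) else 0)"
      by (intro sum.cong) (auto simp: o2 Some)
    also have "\<dots> = ?k w * local_degree f (Some c)"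
      using fin by (auto simp: cone_points_def)
    finally show ?thesis by (simp add: Some)
  qed
  finally have R: "order c (\<Prod>s\<in>?S. (p - smult s q) ^ ?k s)
      = (n - j (f (Some c))) * local_degree f (Some c)" .
  define d where "d = order c (wronskian p q)"
  have d: "local_degree f (Some c) = Suc d"
    using wronskian_local_degree(2)[OF f(2) nc] by (simp add: d_def)
  have jc: "j (Some c) = Suc d * j (f (Some c))"
    using weight_coveringD(3)[OF f(1)] d by metis
  have le: "j (Some c) \<le> n" "j (f (Some c)) \<le> n" using j(1) by (auto simp: weight_def)
  have "n * d + (n - j (Some c)) = (n - j (f (Some c))) * Suc d"
  proof -
    have "(n - j (f (Some c))) * Suc d = n * Suc d - j (Some c)"
      unfolding jc by (metis diff_mult_distrib mult.commute)
    moreover have "n * Suc d = n * d + n" by simp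
    ultimately show ?thesis using le(1) by linarith
  qed
  thus "order c (wronskian p q ^ n * cone_poly n j) = order c (\<Prod>s\<in>?S. (p - smult s q) ^ ?k s)"
    using wronskian_local_degree(1)[OF f(2) nc] T
    by (simp add: order_mult ow L R d flip: d_def)
qed

lemma degree_wronskian:
  assumes "degree q = Suc (degree p)" "p \<noteq> 0"
  shows "degree (wronskian p q) = 2 * degree p"
proof (rule antisym)
  define d where "d = degree p"
  have dq: "degree q = Suc d" "degree p = d" using assms by (auto simp: d_def)
  have 1: "degree (pderiv p * q) \<le> 2 * d"
  proof (cases "d = 0")
    case True
    hence "pderiv p = 0" using dq by (simp add: pderiv_eq_0_iff)
    thus ?thesis by simp
  next
    case False
    have "degree (pderiv p * q) \<le> (d - 1) + Suc d"
      using degree_mult_le[of "pderiv p" q] dq by (simp add: degree_pderiv)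
    with False show ?thesis by simp
  qed
  have 2: "degree (p * pderiv q) \<le> 2 * d"
    using degree_mult_le[of p "pderiv q"] dq by (simp add: degree_pderiv)
  show "degree (wronskian p q) \<le> 2 * degree p"
    unfolding wronskian_def using 1 2 dq by (metis degree_diff_le)
  have c1: "coeff (pderiv p * q) (2 * d) = of_nat d * lead_coeff p * lead_coeff q"
  proof (cases d)
    case 0
    hence "pderiv p = 0" using dq by (simp add: pderiv_eq_0_iff)
    thus ?thesis using 0 by simp
  next
    case (Suc e)
    have "coeff (pderiv p * q) (e + Suc d) = coeff (pderiv p) e * coeff q (Suc d)"
      by (rule coeff_mult_at_bounds) (use dq Suc in \<open>simp_all add: degree_pderiv\<close>)
    thus ?thesis using dq Suc by (simp add: coeff_pderiv mult_2)
  qed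
  have "coeff (p * pderiv q) (d + d) = coeff p d * coeff (pderiv q) d"
    by (rule coeff_mult_at_bounds) (use dq in \<open>simp_all add: degree_pderiv\<close>)
  hence c2: "coeff (p * pderiv q) (2 * d) = of_nat (Suc d) * lead_coeff p * lead_coeff q"
    using dq by (simp add: coeff_pderiv mult_2)
  \<comment> \<open>The two top coefficients would cancel if the degrees of \<open>p\<close> and \<open>q\<close> were equal; here they differ by \<open>1\<close>.\<close>
  have "coeff (wronskian p q) (2 * d) = - (lead_coeff p * lead_coeff q)"
    unfolding wronskian_def coeff_diff c1 c2 by (simp add: algebra_simps)
  moreover have "q \<noteq> 0" using assms(1) by auto
  ultimately have "coeff (wronskian p q) (2 * d) \<noteq> 0" using assms(2) by simp
  thus "2 * degree p \<le> degree (wronskian p q)" using dq le_degree by blast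
qed

text \<open>
The Riemann-Hurwitz count, read off from the degrees in \<open>wronskian_identity\<close>. For the normalisation
\<open>f \<infinity> = 0\<close> with \<open>0\<close> and \<open>\<infinity>\<close> not exceptional, all degrees are known. With \<open>d\<close> the degree of \<open>p\<close>, so
that \<open>f\<close> has degree \<open>d + 1\<close>, and with \<open>k\<close> the sum of the exponents, the identity yields
\<open>2 n d + k = (d + 1) k\<close>.
\<close>

lemma euler_characteristic_normalised:
  assumes j: "weight n j" "j None = n" "j (Some 0) = n" and f: "weight_covering j f"
    and f0: "f None = Some 0" and deg: "rat_degree f \<ge> 2"
  shows "(\<Sum>s\<in>cone_points n j. n - j (Some s)) = 2 * n"
proof -
  let ?S = "cone_points n j" and ?k = "\<lambda>s. n - j (Some s)"
  have nc: "nonconstant f" using f by (rule weight_coveringD)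
  obtain p q where pq: "represents p q f"
    using weight_coveringD(1)[OF f] by (auto simp: rational_function_def)
  note fin = finite_cone_points[OF j(1)]
  have "local_degree f None = 1"
    using weight_covering_at_full_value(2)[OF j(1) f] f0 j(3) by simp
  hence dq: "degree q = Suc (degree p)" and p: "p \<noteq> 0"
    using local_degree_at_infinity[OF pq nc f0] by auto
  define d where "d = degree p"
  have d: "d \<ge> 1" using deg rat_degree_eq[OF pq] dq by (simp add: d_def)
  have nz: "degree (p - smult s q) = Suc d" if "s \<in> ?S" for s
  proof -
    have "s \<noteq> 0" using that j(3) by (auto simp: cone_points_def)
    hence "degree (- smult s q + p) = degree (- smult s q)"
      using dq by (intro degree_add_eq_left) simp
    thus ?thesis using \<open>s \<noteq> 0\<close> dq by (simp add: d_def)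
  qed
  have nz0: "p - smult s q \<noteq> 0" if "s \<in> ?S" for s
    using nz[OF that] by auto
  obtain a where a: "a \<noteq> 0" "wronskian p q ^ n * cone_poly n j
      = smult a (\<Prod>s\<in>?S. (p - smult s q) ^ ?k s)"
    using wronskian_identity[OF j(1,2) f pq] by blast
  have "degree (cone_poly n j) = (\<Sum>s\<in>?S. ?k s)"
    unfolding cone_poly_def by (subst degree_prod_sum_eq) (auto simp: degree_power_eq)
  moreover have "degree (\<Prod>s\<in>?S. (p - smult s q) ^ ?k s) = (\<Sum>s\<in>?S. ?k s * Suc d)"
  proof (subst degree_prod_sum_eq)
    show "(\<Sum>s\<in>?S. degree ((p - smult s q) ^ ?k s)) = (\<Sum>s\<in>?S. ?k s * Suc d)"
      by (intro sum.cong refl) (metis degree_power_eq nz nz0)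
  qed (use nz0 in \<open>simp del: right_minus_eq\<close>)
  moreover have "degree (wronskian p q ^ n * cone_poly n j)
      = n * (2 * d) + degree (cone_poly n j)"
    using wronskian_local_degree(1)[OF pq nc] fin degree_wronskian[OF dq p]
    by (subst degree_mult_eq) (auto simp: cone_poly_def degree_power_eq d_def)
  ultimately have "n * (2 * d) + (\<Sum>s\<in>?S. ?k s) = (\<Sum>s\<in>?S. ?k s) * Suc d"
    using a by (simp add: sum_distrib_right sum.distrib)
  hence "d * (2 * n) = d * (\<Sum>s\<in>?S. ?k s)" by (simp add: algebra_simps)
  thus ?thesis using d by simp
qed

lemma finite_fixed_points:
  assumes "rational_function f" "rat_degree f \<ge> 2"
  shows "finite {x. f x = x}"
proof -
  obtain p q where pq: "represents p q f" using assms by (auto simp: rational_function_def)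
  have "p - [:0, 1:] * q \<noteq> 0"
  proof
    assume "p - [:0, 1:] * q = 0"
    hence p: "p = [:0, 1:] * q" by simp
    have "poly q z \<noteq> 0" for z
      using represents_no_common_root[OF pq, of z] by (auto simp: p)
    hence "degree q = 0" using alg_closed_imp_poly_has_root[of q] by auto
    moreover from this have "degree p \<le> 1"
      unfolding p using degree_mult_le[of "[:0, 1:]" q] by simp
    ultimately show False using assms(2) rat_degree_eq[OF pq] by simp
  qed
  hence "finite (insert None (Some ` {z. poly (p - [:0, 1:] * q) z = 0}))"
    using poly_roots_finite by blast
  moreover have "{x. f x = x} \<subseteq> insert None (Some ` {z. poly (p - [:0, 1:] * q) z = 0})"
  proof
    fix x assume "x \<in> {x. f x = x}"
    thus "x \<in> insert None (Some ` {z. poly (p - [:0, 1:] * q) z = 0})"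
      by (cases x) (auto simp: represents_finite[OF pq] proj_def field_simps split: if_splits)
  qed
  ultimately show ?thesis by (rule finite_subset[rotated])
qed

text \<open>
The normalisation is achieved by moving a point \<open>a\<close> to infinity and \<open>f a\<close> to \<open>0\<close>, where \<open>f a\<close> is neither
exceptional nor equal to \<open>a\<close>; all but finitely many points \<open>a\<close> qualify.
\<close>

lemma euler_characteristic:
  assumes j: "weight n j" and f: "weight_covering j f" and deg: "rat_degree f \<ge> 2"
  shows "(\<Sum>z | j z \<noteq> n. n - j z) = 2 * n"
proof -
  have rf: "rational_function f" "nonconstant f" using f by (auto dest: weight_coveringD)
  have "finite (f -` {z. j z \<noteq> n} \<union> {x. f x = x})"
    using finite_vimage_rational[OF rf, of "{z. j z \<noteq> n}"] finite_fixed_points[OF rf(1) deg] j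
    by (simp add: weight_def)
  moreover have "infinite (UNIV :: sphere set)"
    using infinite_UNIV_char_0[where 'a = complex] by (simp add: finite_option_UNIV)
  ultimately obtain a where "a \<notin> f -` {z. j z \<noteq> n} \<union> {x. f x = x}"
    using ex_new_if_finite by blast
  hence a: "j (f a) = n" "f a \<noteq> a" by auto
  have ja: "j a = n" using weight_covering_at_full_value(1)[OF j f a(1)] .
  obtain b where b: "b \<noteq> a" "b \<noteq> f a"
    using ex_new_if_finite[OF \<open>infinite (UNIV :: sphere set)\<close>, of "{a, f a}"] by auto
  obtain m where m: "invertible_rational m" "m a = None" "m (f a) = Some 0"
    using moebius_to_standard[of a "f a" b] a b by (metis distinct_length_2_or_more distinct_singleton)
  obtain m' where m': "invertible_rational m'" "m \<circ> m' = id" "m' \<circ> m = id"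
    using m(1) by (rule invertible_rationalE)
  have mm: "m (m' x) = x" "m' (m x) = x" for x
    using m' by (metis comp_apply id_apply)+
  define g where "g = m \<circ> f \<circ> m'"
  define i where "i = j \<circ> m'"
  have g: "nonconstant g" "rational_function g"
    unfolding g_def using moebius_conjugate[OF m(1) m'(1) rf] by auto
  have dg: "rat_degree g \<ge> 2"
    unfolding g_def using moebius_conjugate(3)[OF m(1) m'(1) rf] deg by simp
  have ld: "local_degree g x = local_degree f (m' x)" for x
    unfolding g_def by (rule moebius_conjugate(4)[OF m(1) m'(1) rf])
  have set: "{z. i z \<noteq> n} = m ` {z. j z \<noteq> n}"
  proof (intro equalityI subsetI)
    fix z assume "z \<in> {z. i z \<noteq> n}"
    thus "z \<in> m ` {z. j z \<noteq> n}" by (intro image_eqI[of _ _ "m' z"]) (auto simp: i_def mm)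
  qed (auto simp: i_def mm)
  have wi: "weight n i" using j set by (auto simp: weight_def i_def)
  have wg: "weight_covering i g"
    unfolding weight_covering_def
  proof (intro conjI allI)
    show "i z = local_degree g z * i (g z)" for z
    proof -
      have "i (g z) = j (f (m' z))" by (simp add: i_def g_def mm)
      thus ?thesis using weight_coveringD(3)[OF f, of "m' z"] unfolding ld by (simp only: i_def o_def)
    qed
  qed (use g in auto)
  have e: "i None = n" "i (Some 0) = n" "g None = Some 0"
  proof -
    have "m' None = a" "m' (Some 0) = f a" using m(2,3) mm(2) by metis+
    thus "i None = n" "i (Some 0) = n" "g None = Some 0"
      using m(3) a(1) ja by (simp_all only: i_def g_def o_def)
  qed
  have "(\<Sum>z | j z \<noteq> n. n - j z) = (\<Sum>z | i z \<noteq> n. n - i z)"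
    by (rule sum.reindex_bij_witness[of _ m' m]) (auto simp: i_def mm)
  also have "{z. i z \<noteq> n} = Some ` cone_points n i"
  proof (intro equalityI subsetI)
    fix z assume "z \<in> {z. i z \<noteq> n}"
    thus "z \<in> Some ` cone_points n i" using e(1) by (cases z) (auto simp: cone_points_def)
  qed (auto simp: cone_points_def)
  also have "(\<Sum>z\<in>Some ` cone_points n i. n - i z) = (\<Sum>s\<in>cone_points n i. n - i (Some s))"
    by (subst sum.reindex) simp_all
  also have "\<dots> = 2 * n"
    by (rule euler_characteristic_normalised[OF wi e(1,2) wg e(3) dg])
  finally show ?thesis .
qed

section \<open>Germs with a prescribed multiplier\<close>

unbundle no vec_syntax and fps_syntax

text \<open>
Substitution of a power series into a polynomial. Unlike composition of power series it is meaningful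
for every \<open>f\<close>, and it visibly commutes with evaluation at the constant term.
\<close>

definition poly_fps :: "complex poly \<Rightarrow> complex fps \<Rightarrow> complex fps" where
  "poly_fps S f = poly (map_poly fps_const S) f"

lemma poly_fps_0 [simp]: "poly_fps 0 f = 0"
  by (simp add: poly_fps_def)

lemma poly_fps_pCons [simp]: "poly_fps (pCons a S) f = fps_const a + f * poly_fps S f"
  by (cases "a = 0 \<and> S = 0") (auto simp: poly_fps_def map_poly_pCons)

lemma poly_fps_nth_0: "f $ 0 = 0 \<Longrightarrow> poly_fps S f $ 0 = poly S 0"
  by (cases S) auto

lemma poly_fps_diff_dvd: "(f - g) dvd (poly_fps S f - poly_fps S g)"
proof (induction S)
  case (pCons a S)
  have "poly_fps (pCons a S) f - poly_fps (pCons a S) g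
      = (f - g) * poly_fps S f + g * (poly_fps S f - poly_fps S g)"
    by (simp add: algebra_simps)
  thus ?case using pCons.IH by simp
qed simp

lemma has_fps_expansion_poly_compose:
  assumes "f has_fps_expansion F"
  shows "(\<lambda>u. poly S (f u)) has_fps_expansion poly_fps S F"
  by (induction S) (auto intro!: fps_expansion_intros assms)

lemma fps_leading_term:
  fixes f :: "complex fps"
  assumes "f \<noteq> 0" "f $ 0 = 0"
  obtains k \<phi> where "f = fps_X ^ Suc k * \<phi>" "\<phi> $ 0 \<noteq> 0"
    "fps_deriv f = fps_X ^ k * (fps_const (of_nat (Suc k)) * \<phi> + fps_X * fps_deriv \<phi>)"
proof -
  have "subdegree f \<noteq> 0" using assms by (simp add: subdegree_eq_0_iff)
  then obtain k where k: "subdegree f = Suc k" using not0_implies_Suc by blast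
  define \<phi> where "\<phi> = fps_shift (Suc k) f"
  have f: "f = fps_X ^ Suc k * \<phi>"
    using subdegree_decompose[of f] k by (simp add: \<phi>_def mult.commute)
  have "\<phi> $ 0 \<noteq> 0" using assms(1) k by (metis \<phi>_def fps_shift_nth add_0 nth_subdegree_nonzero)
  moreover have "fps_deriv f = fps_X ^ k * (fps_const (of_nat (Suc k)) * \<phi> + fps_X * fps_deriv \<phi>)"
    unfolding f fps_deriv_mult fps_deriv_power
    by (simp add: algebra_simps fps_of_nat del: of_nat_Suc)
  ultimately show ?thesis using that f by blast
qed

text \<open>
Both \<open>f\<close> and \<open>g\<close> solve an equation \<open>(f')\<^sup>n K = f\<^sup>n\<^sup>-\<^sup>1 S(f)\<close> with the same unknown \<open>K\<close>, which has been
eliminated. Comparing lowest terms shows that \<open>f\<close> and \<open>g\<close> have the same order \<open>k + 1\<close> and the same leading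
coefficient: the factor \<open>f\<^sup>n\<^sup>-\<^sup>1\<close> leaves the leading coefficient to the first power, hence no root of
unity remains free. If \<open>g = f c\<close> with \<open>c = 1 + X\<^sup>i\<^sup>+\<^sup>1 e\<close> and \<open>e(0) \<noteq> 0\<close>, the first order terms in \<open>e\<close> give
\<open>(k + 1) + (i + 1) n = 0\<close> up to nonzero factors, which is absurd.
\<close>

lemma fps_with_equal_multiplier_unique:
  fixes f g :: "complex fps"
  assumes f: "f \<noteq> 0" "f $ 0 = 0" and g: "g \<noteq> 0" "g $ 0 = 0"
    and n: "n > 0" and S: "poly S 0 \<noteq> 0"
    and eq: "fps_deriv f ^ n * g ^ (n - 1) * poly_fps S g
      = fps_deriv g ^ n * f ^ (n - 1) * poly_fps S f"
  shows "f = g"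
proof -
  obtain k \<phi> where F: "f = fps_X ^ Suc k * \<phi>" "\<phi> $ 0 \<noteq> 0"
    "fps_deriv f = fps_X ^ k * (fps_const (of_nat (Suc k)) * \<phi> + fps_X * fps_deriv \<phi>)"
    using fps_leading_term[OF f] by blast
  obtain l \<psi> where G: "g = fps_X ^ Suc l * \<psi>" "\<psi> $ 0 \<noteq> 0"
    "fps_deriv g = fps_X ^ l * (fps_const (of_nat (Suc l)) * \<psi> + fps_X * fps_deriv \<psi>)"
    using fps_leading_term[OF g] by blast
  define \<phi>' where "\<phi>' = fps_const (of_nat (Suc k)) * \<phi> + fps_X * fps_deriv \<phi>"
  define \<psi>' where "\<psi>' = fps_const (of_nat (Suc l)) * \<psi> + fps_X * fps_deriv \<psi>"
  obtain m where m: "n = Suc m" using n gr0_implies_Suc by blast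
  have c0: "\<phi>' $ 0 = of_nat (Suc k) * \<phi> $ 0" "\<psi>' $ 0 = of_nat (Suc l) * \<psi> $ 0"
    by (simp_all add: \<phi>'_def \<psi>'_def del: of_nat_Suc)
  hence nz: "\<phi>' $ 0 \<noteq> 0" "\<psi>' $ 0 \<noteq> 0" using F(2) G(2) by (simp_all del: of_nat_Suc)
  define L where "L = \<phi>' ^ n * \<psi> ^ m * poly_fps S g"
  define R where "R = \<psi>' ^ n * \<phi> ^ m * poly_fps S f"
  have LR0: "L $ 0 = (\<phi>' $ 0) ^ n * (\<psi> $ 0) ^ m * poly S 0"
    "R $ 0 = (\<psi>' $ 0) ^ n * (\<phi> $ 0) ^ m * poly S 0"
    by (simp_all add: L_def R_def fps_nth_power_0 poly_fps_nth_0 f(2) g(2))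
  hence LRnz: "L $ 0 \<noteq> 0" "R $ 0 \<noteq> 0" using nz F(2) G(2) S by auto
  \<comment> \<open>Both sides of the hypothesis with all powers of \<open>X\<close> collected; \<open>L\<close> and \<open>R\<close> are units.\<close>
  have e: "fps_X ^ (k * n + Suc l * m) * L = fps_X ^ (l * n + Suc k * m) * R"
  proof -
    have "fps_deriv f ^ n * g ^ m * poly_fps S g = fps_X ^ (k * n + Suc l * m) * L"
      unfolding F(3) \<phi>'_def[symmetric] L_def
      by (subst (1) G(1)) (simp add: power_mult_distrib power_add power_mult mult_ac)
    moreover have "fps_deriv g ^ n * f ^ m * poly_fps S f = fps_X ^ (l * n + Suc k * m) * R"
      unfolding G(3) \<psi>'_def[symmetric] R_def
      by (subst (1) F(1)) (simp add: power_mult_distrib power_add power_mult mult_ac)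
    ultimately show ?thesis using eq by (simp add: m)
  qed
  have "subdegree (fps_X ^ (k * n + Suc l * m) * L) = k * n + Suc l * m"
    "subdegree (fps_X ^ (l * n + Suc k * m) * R) = l * n + Suc k * m"
    using LRnz by (auto simp: subdegree_eq_0 fps_nonzeroI)
  hence "k * n + Suc l * m = l * n + Suc k * m" using e by simp
  hence lk: "l = k" by (simp add: m)
  hence "L = R" using e by simp
  hence "\<psi> $ 0 = \<phi> $ 0"
    using LR0 F(2) G(2) S c0 by (simp add: m lk power_mult_distrib mult_ac del: of_nat_Suc)
  show ?thesis
  proof (rule ccontr)
    assume "f \<noteq> g"
    define c where "c = \<psi> * inverse \<phi>"
    have \<psi>: "\<psi> = \<phi> * c"
      using F(2) by (simp add: c_def mult.left_commute inverse_mult_eq_1')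
    have c1: "c $ 0 = 1" using \<open>\<psi> $ 0 = \<phi> $ 0\<close> F(2) by (simp add: c_def)
    have "c - 1 \<noteq> 0" using \<open>f \<noteq> g\<close> F(1) G(1) \<psi> lk by auto
    then obtain i e where E: "c - 1 = fps_X ^ Suc i * e" "e $ 0 \<noteq> 0"
      "fps_deriv (c - 1) = fps_X ^ i * (fps_const (of_nat (Suc i)) * e + fps_X * fps_deriv e)"
      using fps_leading_term[of "c - 1"] c1 by auto
    \<comment> \<open>Here \<open>X c' = X\<^sup>i\<^sup>+\<^sup>1 \<theta>\<close>; the constant term of \<open>\<theta>\<close> is \<open>(i + 1) e(0)\<close>.\<close>
    define \<theta> where "\<theta> = fps_const (of_nat (Suc i)) * e + fps_X * fps_deriv e"
    have dc: "fps_X * fps_deriv c = fps_X ^ Suc i * \<theta>"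
      using E(3) by (simp add: \<theta>_def mult.assoc)
    have \<psi>': "\<psi>' = \<phi>' * c + fps_X ^ Suc i * \<phi> * \<theta>"
    proof -
      have "\<psi>' = \<phi>' * c + \<phi> * (fps_X * fps_deriv c)"
        unfolding \<psi>'_def \<phi>'_def \<psi> lk by (simp add: algebra_simps)
      thus ?thesis unfolding dc by (simp add: mult_ac)
    qed
    \<comment> \<open>The cofactor in the factorisation of \<open>\<psi>'\<^sup>n - (\<phi>' c)\<^sup>n\<close>.\<close>
    define Q where "Q = (\<Sum>r<n. (\<phi>' * c) ^ (n - Suc r) * \<psi>' ^ r)"
    have pw: "\<psi>' ^ n = \<phi>' ^ n * c ^ n + fps_X ^ Suc i * \<phi> * \<theta> * Q"
      using power_diff_sumr2[of \<psi>' n "\<phi>' * c"] \<psi>'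
      by (simp add: Q_def power_mult_distrib algebra_simps)
    have "\<psi>' $ 0 = \<phi>' $ 0" using c0 lk \<open>\<psi> $ 0 = \<phi> $ 0\<close> by simp
    hence "Q $ 0 = (\<Sum>r<n. (\<phi>' $ 0) ^ (n - Suc r) * (\<phi>' $ 0) ^ r)"
      by (simp add: Q_def fps_sum_nth fps_nth_power_0 c1)
    also have "\<dots> = (\<Sum>r<n. (\<phi>' $ 0) ^ m)"
      by (intro sum.cong refl) (simp add: m flip: power_add)
    finally have Q0: "Q $ 0 = of_nat n * (\<phi>' $ 0) ^ m" by simp
    obtain D where D: "poly_fps S g - poly_fps S f = (g - f) * D"
      using poly_fps_diff_dvd[of g f S] by (auto elim: dvdE)
    have gf: "g - f = fps_X ^ Suc k * \<phi> * (fps_X ^ Suc i * e)"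
      unfolding G(1) F(1) lk \<psi> E(1)[symmetric] by (simp add: algebra_simps)
    have "\<phi> ^ m * (\<phi>' ^ n * c ^ m * poly_fps S g) = \<phi> ^ m * (\<psi>' ^ n * poly_fps S f)"
      using \<open>L = R\<close> by (simp add: L_def R_def \<psi> power_mult_distrib mult_ac)
    hence "\<phi>' ^ n * c ^ m * poly_fps S g = \<psi>' ^ n * poly_fps S f"
      using F(2) by (auto simp: fps_nonzeroI)
    moreover have "poly_fps S g = poly_fps S f + fps_X ^ Suc k * \<phi> * (fps_X ^ Suc i * e) * D"
      using D unfolding gf by (simp add: algebra_simps)
    moreover have "c ^ n = c ^ m + c ^ m * (fps_X ^ Suc i * e)"
      unfolding E(1)[symmetric] by (simp add: m algebra_simps)
    ultimately have "fps_X ^ Suc i * (\<phi>' ^ n * c ^ m * e * poly_fps S f + \<phi> * \<theta> * Q * poly_fps S f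
        - \<phi>' ^ n * c ^ m * fps_X ^ Suc k * \<phi> * e * D) = 0"
      unfolding pw by (simp add: algebra_simps)
    hence "\<phi>' ^ n * c ^ m * e * poly_fps S f + \<phi> * \<theta> * Q * poly_fps S f
        - \<phi>' ^ n * c ^ m * fps_X ^ Suc k * \<phi> * e * D = 0"
      by simp
    from arg_cong[OF this, of "\<lambda>h. h $ 0"]
    have "(\<phi>' $ 0) ^ n * e $ 0 * poly S 0 + \<phi> $ 0 * (of_nat (Suc i) * e $ 0) * (of_nat n * (\<phi>' $ 0) ^ m) * poly S 0 = 0"
      by (simp add: fps_nth_power_0 c1 poly_fps_nth_0 f(2) Q0 \<theta>_def del: of_nat_Suc)
    hence "(\<phi>' $ 0) ^ m * \<phi> $ 0 * e $ 0 * poly S 0 * (of_nat (Suc k) + of_nat (Suc i) * of_nat n) = 0"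
      unfolding m c0 by (simp add: algebra_simps del: of_nat_Suc)
    hence "of_nat (Suc k) + of_nat (Suc i) * of_nat n = (0 :: complex)"
      using nz F(2) E(2) S by simp
    hence "of_nat (Suc k + Suc i * n) = (0 :: complex)" by (simp only: of_nat_add of_nat_mult)
    thus False by (simp del: of_nat_Suc of_nat_add of_nat_mult)
  qed
qed

unbundle vec_syntax and no fps_syntax

section \<open>Multipliers\<close>

text \<open>
The restriction of \<open>f\<close> to the finite points, as a function to which the differential calculus applies away
from the poles.
\<close>

definition affine_part :: "(sphere \<Rightarrow> sphere) \<Rightarrow> complex \<Rightarrow> complex" where
  "affine_part f z = the (f (Some z))"

text \<open>
\<open>a\<close> is the factor by which pulling back along \<open>f\<close> changes \<open>dz\<^sup>n / T(z)\<close>. Asking for the equation at all but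
finitely many points avoids poles and lets the chain rule apply without further conditions.
\<close>

definition multiplier :: "nat \<Rightarrow> (sphere \<Rightarrow> nat) \<Rightarrow> (sphere \<Rightarrow> sphere) \<Rightarrow> complex \<Rightarrow> bool" where
  "multiplier n j f a \<longleftrightarrow> (\<forall>\<^sub>F z in cofinite. \<exists>w d. f (Some z) = Some w \<and>
     (affine_part f has_field_derivative d) (at z) \<and>
     d ^ n * poly (cone_poly n j) z = a * poly (cone_poly n j) w)"

lemma eventually_at_if_cofinite:
  fixes z :: complex
  assumes "\<forall>\<^sub>F z in cofinite. P z"
  shows "\<forall>\<^sub>F x in at z. P x"
proof -
  have "finite {x. \<not> P x}" using assms by (simp add: eventually_cofinite)
  from islimpt_finite[OF this, of z] show ?thesis
    by (simp add: islimpt_iff_eventually frequently_def)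
qed

lemma cofinite_not_poly_root:
  "(p :: complex poly) \<noteq> 0 \<Longrightarrow> \<forall>\<^sub>F z in cofinite. poly p z \<noteq> 0"
  using poly_roots_finite[of p] by (simp add: eventually_cofinite)

lemma cofinite_rational:
  assumes "rational_function f" "nonconstant f" "finite W"
  shows "\<forall>\<^sub>F z in cofinite. f (Some z) \<notin> W"
proof -
  have "finite (Some -` (f -` W))"
    using finite_vimage_rational[OF assms] by (rule finite_vimageI) simp
  thus ?thesis by (simp add: eventually_cofinite vimage_def)
qed

lemma affine_part_derivative:
  assumes "represents p q f" "poly q z \<noteq> 0"
  shows "f (Some z) = Some (poly p z / poly q z)"
    and "(affine_part f has_field_derivative poly (wronskian p q) z / (poly q z)\<^sup>2) (at z)"
    and "affine_part f analytic_on {z}"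
proof -
  have f: "f (Some x) = Some (poly p x / poly q x)" if "poly q x \<noteq> 0" for x
    using that by (simp add: represents_finite[OF assms(1)] proj_def)
  thus "f (Some z) = Some (poly p z / poly q z)" using assms(2) by blast
  have op: "open {x. poly q x \<noteq> 0}"
    by (intro open_Collect_neq continuous_intros)
  have deriv: "(affine_part f has_field_derivative poly (wronskian p q) x / (poly q x)\<^sup>2) (at x)"
    if "poly q x \<noteq> 0" for x
  proof (rule has_field_derivative_transform_within_open[OF _ op])
    show "((\<lambda>x. poly p x / poly q x) has_field_derivative
        poly (wronskian p q) x / (poly q x)\<^sup>2) (at x)"
      using that by (auto intro!: derivative_eq_intros simp: wronskian_def power2_eq_square)
  qed (use that f in \<open>auto simp: affine_part_def\<close>)
  show "(affine_part f has_field_derivative poly (wronskian p q) z / (poly q z)\<^sup>2) (at z)"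
    using deriv assms(2) .
  show "affine_part f analytic_on {z}"
    unfolding analytic_at
    using op assms(2) deriv
    by (intro exI[of _ "{x. poly q x \<noteq> 0}"])
      (auto simp: holomorphic_on_open)
qed

lemma cone_poly_nonzero: "weight n j \<Longrightarrow> cone_poly n j \<noteq> 0"
  by (simp add: cone_poly_def finite_cone_points)

text \<open>
Dividing \<open>wronskian_identity\<close> by \<open>q\<^sup>2\<^sup>n\<close> turns both sides into functions of \<open>z\<close> and \<open>f z\<close>; the exponents add
up to \<open>2 n\<close>, which is exactly what makes the right-hand side \<open>T(f z)\<close>.
\<close>

lemma multiplier_exists:
  assumes j: "weight n j" "j None = n" "(\<Sum>s\<in>cone_points n j. n - j (Some s)) = 2 * n"
    and f: "weight_covering j f"
  shows "\<exists>a. a \<noteq> 0 \<and> multiplier n j f a"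
proof -
  let ?S = "cone_points n j" and ?k = "\<lambda>s. n - j (Some s)"
  obtain p q where pq: "represents p q f"
    using weight_coveringD(1)[OF f] by (auto simp: rational_function_def)
  obtain a where a: "a \<noteq> 0" "wronskian p q ^ n * cone_poly n j
      = smult a (\<Prod>s\<in>?S. (p - smult s q) ^ ?k s)"
    using wronskian_identity[OF j(1,2) f pq] by blast
  have q: "q \<noteq> 0" using pq by (simp add: represents_def)
  have "\<forall>\<^sub>F z in cofinite. \<exists>w d. f (Some z) = Some w \<and>
     (affine_part f has_field_derivative d) (at z) \<and>
     d ^ n * poly (cone_poly n j) z = a * poly (cone_poly n j) w"
    using cofinite_not_poly_root[OF q]
  proof eventually_elim
    fix z assume z: "poly q z \<noteq> 0"
    let ?w = "poly p z / poly q z"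
    have "poly (p - smult s q) z = poly q z * (?w - s)" for s
      using z by (simp add: field_simps)
    hence "(\<Prod>s\<in>?S. poly (p - smult s q) z ^ ?k s)
        = (\<Prod>s\<in>?S. poly q z ^ ?k s) * (\<Prod>s\<in>?S. (?w - s) ^ ?k s)"
      by (simp only: power_mult_distrib prod.distrib)
    also have "(\<Prod>s\<in>?S. poly q z ^ ?k s) = ((poly q z)\<^sup>2) ^ n"
      by (simp only: power_sum[symmetric] j(3) power_mult)
    also have "(\<Prod>s\<in>?S. (?w - s) ^ ?k s) = poly (cone_poly n j) ?w"
      by (simp add: cone_poly_def poly_prod poly_power)
    finally have "poly (wronskian p q ^ n * cone_poly n j) z
        = a * (((poly q z)\<^sup>2) ^ n * poly (cone_poly n j) ?w)"
      unfolding a(2) by (simp add: poly_prod poly_power del: poly_diff)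
    hence "(poly (wronskian p q) z / (poly q z)\<^sup>2) ^ n * poly (cone_poly n j) z
        = a * poly (cone_poly n j) ?w"
      using z by (simp add: poly_power power_divide field_simps)
    thus "\<exists>w d. f (Some z) = Some w \<and> (affine_part f has_field_derivative d) (at z) \<and>
        d ^ n * poly (cone_poly n j) z = a * poly (cone_poly n j) w"
      using affine_part_derivative[OF pq z] by blast
  qed
  thus ?thesis using a(1) by (auto simp: multiplier_def)
qed

text \<open>
The chain rule; a rational map has finite fibres, so cofinitely many points are mapped to good points.
\<close>

lemma multiplier_compose:
  assumes f: "multiplier n j f a" and g: "multiplier n j g b"
    and rat: "rational_function g" "nonconstant g"
  shows "multiplier n j (f \<circ> g) (a * b)"
proof -
  let ?T = "cone_poly n j"
  define good where "good = (\<lambda>w. \<exists>v d. f (Some w) = Some v \<and>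
     (affine_part f has_field_derivative d) (at w) \<and> d ^ n * poly ?T w = a * poly ?T v)"
  have fin: "finite (Some ` {w. \<not> good w})"
    using f by (auto simp: good_def multiplier_def eventually_cofinite)
  have "\<forall>\<^sub>F z in cofinite. g (Some z) \<notin> insert None (Some ` {w. \<not> good w})"
    by (rule cofinite_rational[OF rat]) (use fin in simp)
  hence gd: "\<forall>\<^sub>F z in cofinite. \<exists>w. g (Some z) = Some w \<and> good w"
  proof eventually_elim
    case (elim z)
    thus ?case by (cases "g (Some z)") auto
  qed
  have loc: "\<forall>\<^sub>F x in at z. affine_part (f \<circ> g) x = affine_part f (affine_part g x)" for z
    using eventually_at_if_cofinite[OF gd, of z]
    by eventually_elim (auto simp: affine_part_def)
  have "\<forall>\<^sub>F z in cofinite. \<exists>v d. (f \<circ> g) (Some z) = Some v \<and>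
     (affine_part (f \<circ> g) has_field_derivative d) (at z) \<and> d ^ n * poly ?T z = (a * b) * poly ?T v"
    using g[unfolded multiplier_def] gd
  proof eventually_elim
    fix z
    assume "\<exists>w d. g (Some z) = Some w \<and> (affine_part g has_field_derivative d) (at z) \<and>
      d ^ n * poly ?T z = b * poly ?T w" and "\<exists>w. g (Some z) = Some w \<and> good w"
    then obtain w d v e where *: "g (Some z) = Some w" "(affine_part g has_field_derivative d) (at z)"
      "d ^ n * poly ?T z = b * poly ?T w" "f (Some w) = Some v"
      "(affine_part f has_field_derivative e) (at w)" "e ^ n * poly ?T w = a * poly ?T v"
      unfolding good_def by auto
    have gz: "affine_part g z = w" using *(1) by (simp add: affine_part_def)
    have "(affine_part f \<circ> affine_part g has_field_derivative e * d) (at z)"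
      using *(2,5) by (intro DERIV_chain) (simp_all add: gz)
    moreover have "\<forall>\<^sub>F x in nhds z. (affine_part f \<circ> affine_part g) x = affine_part (f \<circ> g) x"
      using loc[of z] *(1,4) unfolding eventually_nhds_conv_at
      by (auto simp: affine_part_def elim: eventually_mono)
    ultimately have "(affine_part (f \<circ> g) has_field_derivative e * d) (at z)"
      using DERIV_cong_ev[OF refl _ refl] by blast
    moreover have "(e * d) ^ n * poly ?T z = (a * b) * poly ?T v"
    proof -
      have "(e * d) ^ n * poly ?T z = e ^ n * (d ^ n * poly ?T z)"
        by (simp add: power_mult_distrib)
      also have "\<dots> = b * (e ^ n * poly ?T w)" by (simp add: *(3))
      also have "\<dots> = (a * b) * poly ?T v" by (simp add: *(6))
      finally show ?thesis .
    qed
    ultimately show "\<exists>v d. (f \<circ> g) (Some z) = Some v \<and>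
     (affine_part (f \<circ> g) has_field_derivative d) (at z) \<and> d ^ n * poly ?T z = (a * b) * poly ?T v"
      using *(1,4) by auto
  qed
  thus ?thesis by (simp add: multiplier_def)
qed

lemma multiplier_unique:
  assumes j: "weight n j" and f: "rational_function f" "nonconstant f"
    and a: "multiplier n j f a" and b: "multiplier n j f b"
  shows "a = b"
proof -
  let ?T = "cone_poly n j"
  have "finite (Some ` {w. poly ?T w = 0})"
    using poly_roots_finite[OF cone_poly_nonzero[OF j]] by simp
  from cofinite_rational[OF f this] a b
  have "\<forall>\<^sub>F z in (cofinite :: complex filter). a = b"
    unfolding multiplier_def
  proof eventually_elim
    fix z
    assume nz: "f (Some z) \<notin> Some ` {w. poly ?T w = 0}"
      and "\<exists>w d. f (Some z) = Some w \<and> (affine_part f has_field_derivative d) (at z) \<and>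
        d ^ n * poly ?T z = a * poly ?T w"
      and "\<exists>w d. f (Some z) = Some w \<and> (affine_part f has_field_derivative d) (at z) \<and>
        d ^ n * poly ?T z = b * poly ?T w"
    then obtain w d e where *: "f (Some z) = Some w"
      "(affine_part f has_field_derivative d) (at z)" "d ^ n * poly ?T z = a * poly ?T w"
      "(affine_part f has_field_derivative e) (at z)" "e ^ n * poly ?T z = b * poly ?T w"
      by auto
    have "d = e" using *(2,4) DERIV_unique by blast
    moreover have "poly ?T w \<noteq> 0" using nz *(1) by auto
    ultimately show "a = b" using *(3,5) by simp
  qed
  thus ?thesis using infinite_UNIV_char_0[where 'a = complex] by (simp add: eventually_cofinite)
qed

text \<open>
The multiplier of \<open>B \<circ> Y = Y \<circ> A\<close> can be computed in two ways, and that of \<open>Y\<close> cancels.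
\<close>

lemma equal_multipliers_if_semiconjugate:
  assumes j: "weight n j" "j None = n" "(\<Sum>s\<in>cone_points n j. n - j (Some s)) = 2 * n"
    and A: "weight_covering j A" and B: "weight_covering j B" and Y: "weight_covering j Y"
    and eq: "B \<circ> Y = Y \<circ> A"
  shows "\<exists>a. a \<noteq> 0 \<and> multiplier n j A a \<and> multiplier n j B a"
proof -
  obtain a b c where *: "a \<noteq> 0" "multiplier n j A a" "multiplier n j B b" "c \<noteq> 0" "multiplier n j Y c"
    using multiplier_exists[OF j] A B Y by metis
  note AYB = weight_coveringD(1,2)[OF A] weight_coveringD(1,2)[OF B] weight_coveringD(1,2)[OF Y]
  have "multiplier n j (B \<circ> Y) (b * c)"
    using multiplier_compose * AYB by blast
  moreover have "multiplier n j (B \<circ> Y) (c * a)"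
    unfolding eq using multiplier_compose * AYB by blast
  moreover have "nonconstant (B \<circ> Y)" using nonconstant_compose AYB by blast
  moreover from this have "rational_function (B \<circ> Y)" using rational_function_compose(1) AYB by blast
  ultimately have "b * c = c * a" using multiplier_unique[OF j(1)] by blast
  hence "a = b" using *(4) by simp
  thus ?thesis using * by blast
qed

lemma rational_eq_if_eventually_eq:
  assumes "rational_function f" "rational_function g"
    and "\<forall>\<^sub>F x in at s. f (Some x) = g (Some x)"
  shows "f = g"
proof -
  obtain p q r t where *: "represents p q f" "represents r t g"
    using assms(1,2) by (auto simp: rational_function_def)
  have nz: "q \<noteq> 0" "t \<noteq> 0" using * by (auto simp: represents_def)
  have "\<forall>\<^sub>F x in at s. poly (p * t - r * q) x = 0"
    using assms(3) eventually_at_if_cofinite[OF cofinite_not_poly_root[OF nz(1)], of s]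
      eventually_at_if_cofinite[OF cofinite_not_poly_root[OF nz(2)], of s]
    by eventually_elim (auto simp: represents_finite[OF *(1)] represents_finite[OF *(2)] proj_def
        field_simps)
  hence False if "p * t - r * q \<noteq> 0"
    using eventually_conj[OF _ eventually_at_if_cofinite[OF cofinite_not_poly_root[OF that], of s]]
    by fastforce
  hence eq: "p * t = r * q" by auto
  have same: "f (Some z) = g (Some z)" for z
  proof -
    have "poly p z * poly t z = poly r z * poly q z" using eq by (metis poly_mult)
    thus ?thesis
      using represents_no_common_root[OF *(1), of z] represents_no_common_root[OF *(2), of z]
      by (auto simp: represents_finite[OF *(1)] represents_finite[OF *(2)] proj_def field_simps)
  qed
  have inf: "f None = g None"
  proof -
    define m where "m = max (degree p) (degree q)"
    define l where "l = max (degree r) (degree t)"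
    have "coeff (p * t) (m + l) = coeff p m * coeff t l" "coeff (r * q) (l + m) = coeff r l * coeff q m"
      by (rule coeff_mult_at_bounds; simp add: m_def l_def)+
    hence "coeff p m * coeff t l = coeff r l * coeff q m" using eq by (simp add: add.commute)
    thus ?thesis
      using represents_top_coeff[OF *(1) m_def] represents_top_coeff[OF *(2) l_def]
      by (auto simp: represents_infinity[OF *(1) m_def] represents_infinity[OF *(2) l_def] proj_def
          field_simps)
  qed
  show "f = g"
  proof
    fix x show "f x = g x" using same inf by (cases x) auto
  qed
qed

text \<open>
The hypothesis \<open>j t = 1\<close> says that the index of the common value \<open>t\<close> is \<open>n\<close>, so that \<open>T\<close> vanishes at \<open>t\<close> to
order exactly \<open>n - 1\<close>. In the coordinates \<open>z - s\<close> and \<open>w - t\<close> the two multiplier equations therefore have the shape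
treated in \<open>fps_with_equal_multiplier_unique\<close>. The germs at \<open>s\<close> agree, hence so do the rational functions.
\<close>

lemma covering_determined_by_multiplier:
  assumes j: "weight n j"
    and A: "rational_function A" "nonconstant A" "multiplier n j A a" "A (Some s) = Some t"
    and B: "rational_function B" "nonconstant B" "multiplier n j B a" "B (Some s) = Some t"
    and a: "a \<noteq> 0" and t: "j (Some t) = 1"
  shows "A = B"
proof -
  let ?T = "cone_poly n j"
  have n: "n > 0" using j by (simp add: weight_def)
  obtain S where S: "?T = [:-t, 1:] ^ (n - 1) * S" "poly S t \<noteq> 0"
    using order_decomp[OF cone_poly_nonzero[OF j], of t] order_cone_poly[OF j, of t] t
    by (auto simp: poly_eq_0_iff_dvd)
  define S' where "S' = pcompose S [:t, 1:]"
  have T: "poly ?T (t + u) = u ^ (n - 1) * poly S' u" for u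
    unfolding S(1) S'_def by (simp add: poly_power poly_pcompose)
  have germ: "\<exists>F. (\<lambda>u. affine_part f (s + u) - t) has_fps_expansion F \<and> F \<noteq> 0 \<and> fps_nth F 0 = 0"
    if f: "rational_function f" "nonconstant f" "f (Some s) = Some t" for f
  proof -
    obtain p q where pq: "represents p q f" using f(1) by (auto simp: rational_function_def)
    have q: "poly q s \<noteq> 0"
      using f(3) by (auto simp: represents_finite[OF pq] proj_def split: if_splits)
    obtain G where G: "(\<lambda>u. affine_part f (s + u)) has_fps_expansion G"
      using analytic_at_imp_has_fps_expansion[OF affine_part_derivative(3)[OF pq q]] by blast
    have F: "(\<lambda>u. affine_part f (s + u) - t) has_fps_expansion (G - fps_const t)"
      by (intro fps_expansion_intros G)
    have "fps_nth (G - fps_const t) 0 = 0"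
      using has_fps_expansion_imp_0_eq_fps_nth_0[OF F] f(3) by (simp add: affine_part_def)
    moreover have "G - fps_const t \<noteq> 0"
    proof
      assume 0: "G - fps_const t = 0"
      have "\<forall>\<^sub>F u in at 0. affine_part f (s + u) - t = 0"
        using F unfolding 0 has_fps_expansion_0_iff by (simp add: eventually_nhds_conv_at)
      hence "\<forall>\<^sub>F x in at s. affine_part f x - t = 0"
        unfolding eventually_at_to_0[of _ s] by (simp add: add.commute)
      moreover have "\<forall>\<^sub>F x in at s. f (Some x) \<notin> {Some t, None}"
        by (intro eventually_at_if_cofinite cofinite_rational f(1,2)) simp
      ultimately have "\<forall>\<^sub>F x in at s. False"
        by eventually_elim (auto simp: affine_part_def)
      thus False by simp
    qed
    ultimately show ?thesis using F by blast
  qed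
  obtain F where F: "(\<lambda>u. affine_part A (s + u) - t) has_fps_expansion F" "F \<noteq> 0" "fps_nth F 0 = 0"
    using germ[OF A(1,2,4)] by blast
  obtain G where G: "(\<lambda>u. affine_part B (s + u) - t) has_fps_expansion G" "G \<noteq> 0" "fps_nth G 0 = 0"
    using germ[OF B(1,2,4)] by blast
  define \<alpha> where "\<alpha> = (\<lambda>u. affine_part A (s + u) - t)"
  define \<beta> where "\<beta> = (\<lambda>u. affine_part B (s + u) - t)"
  have ode: "\<forall>\<^sub>F u in at 0. deriv (\<lambda>u. affine_part f (s + u) - t) u ^ n * poly ?T (s + u)
      = a * ((affine_part f (s + u) - t) ^ (n - 1) * poly S' (affine_part f (s + u) - t))"
    if "multiplier n j f a" for f
  proof -
    have "\<forall>\<^sub>F x in at s. \<exists>w d. f (Some x) = Some w \<and>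
       (affine_part f has_field_derivative d) (at x) \<and> d ^ n * poly ?T x = a * poly ?T w"
      using that unfolding multiplier_def by (rule eventually_at_if_cofinite)
    hence "\<forall>\<^sub>F u in at 0. \<exists>w d. f (Some (s + u)) = Some w \<and>
       (affine_part f has_field_derivative d) (at (s + u)) \<and> d ^ n * poly ?T (s + u) = a * poly ?T w"
      by (subst (asm) eventually_at_to_0) (simp add: add.commute)
    thus ?thesis
    proof eventually_elim
      fix u
      assume "\<exists>w d. f (Some (s + u)) = Some w \<and>
       (affine_part f has_field_derivative d) (at (s + u)) \<and> d ^ n * poly ?T (s + u) = a * poly ?T w"
      then obtain w d where *: "f (Some (s + u)) = Some w"
        "(affine_part f has_field_derivative d) (at (s + u))" "d ^ n * poly ?T (s + u) = a * poly ?T w"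
        by blast
      have "((\<lambda>u. affine_part f (s + u)) has_field_derivative d) (at u)"
      proof -
        have "(affine_part f has_field_derivative d) (at (u + s))"
          using *(2) by (simp add: add.commute)
        hence "((\<lambda>u. affine_part f (u + s)) has_field_derivative d) (at u)"
          by (simp only: DERIV_shift)
        thus ?thesis by (simp add: add.commute)
      qed
      hence "((\<lambda>u. affine_part f (s + u) - t) has_field_derivative d) (at u)"
        by (auto intro!: derivative_eq_intros)
      hence "deriv (\<lambda>u. affine_part f (s + u) - t) u = d" by (rule DERIV_imp_deriv)
      moreover have "poly ?T w = (w - t) ^ (n - 1) * poly S' (w - t)" using T[of "w - t"] by simp
      ultimately show "deriv (\<lambda>u. affine_part f (s + u) - t) u ^ n * poly ?T (s + u)
        = a * ((affine_part f (s + u) - t) ^ (n - 1) * poly S' (affine_part f (s + u) - t))"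
        using * by (simp add: affine_part_def)
    qed
  qed
  have Tnz: "\<forall>\<^sub>F u in at 0. poly ?T (s + u) \<noteq> 0"
  proof -
    have "\<forall>\<^sub>F x in at s. poly ?T x \<noteq> 0"
      by (intro eventually_at_if_cofinite cofinite_not_poly_root cone_poly_nonzero j)
    thus ?thesis by (subst (asm) eventually_at_to_0) (simp add: add.commute)
  qed
  let ?H = "fps_deriv F ^ n * G ^ (n - 1) * poly_fps S' G - fps_deriv G ^ n * F ^ (n - 1) * poly_fps S' F"
  \<comment> \<open>The difference of the two multiplier equations after eliminating \<open>T(s + u)\<close>; its expansion is \<open>H\<close>.\<close>
  define h where "h = (\<lambda>u. deriv \<alpha> u ^ n * \<beta> u ^ (n - 1) * poly S' (\<beta> u)
      - deriv \<beta> u ^ n * \<alpha> u ^ (n - 1) * poly S' (\<alpha> u))"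
  have H: "h has_fps_expansion ?H"
    unfolding h_def using F(1) G(1) unfolding \<alpha>_def[symmetric] \<beta>_def[symmetric]
    by (intro fps_expansion_intros has_fps_expansion_poly_compose)
  have "\<forall>\<^sub>F u in at 0. h u = 0"
    using ode[OF A(3)] ode[OF B(3)] Tnz unfolding \<alpha>_def[symmetric] \<beta>_def[symmetric]
  proof eventually_elim
    fix u
    assume 1: "deriv \<alpha> u ^ n * poly ?T (s + u) = a * ((affine_part A (s + u) - t) ^ (n - 1) * poly S' (affine_part A (s + u) - t))"
      and 2: "deriv \<beta> u ^ n * poly ?T (s + u) = a * ((affine_part B (s + u) - t) ^ (n - 1) * poly S' (affine_part B (s + u) - t))"
      and 3: "poly ?T (s + u) \<noteq> 0"
    have "poly ?T (s + u) * h u = (deriv \<alpha> u ^ n * poly ?T (s + u)) * (\<beta> u ^ (n - 1) * poly S' (\<beta> u))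
        - (deriv \<beta> u ^ n * poly ?T (s + u)) * (\<alpha> u ^ (n - 1) * poly S' (\<alpha> u))"
      by (simp add: h_def algebra_simps)
    also have "\<dots> = 0"
      unfolding 1 2 unfolding \<alpha>_def[symmetric, THEN fun_cong] \<beta>_def[symmetric, THEN fun_cong]
      by (simp add: algebra_simps)
    finally show "h u = 0" using 3 by simp
  qed
  hence "fps_to_fls ?H = 0"
    using has_laurent_expansion_eventually_zero_iff[of h 0 "fps_to_fls ?H"]
      has_laurent_expansion_fps[OF H] by simp
  hence "?H = 0" by simp
  hence "F = G"
    using fps_with_equal_multiplier_unique[OF F(2,3) G(2,3) n, of S'] S(2)
    by (simp add: S'_def poly_pcompose)
  have "(\<lambda>u. \<alpha> u - \<beta> u) has_fps_expansion F - G"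
    unfolding \<alpha>_def \<beta>_def by (intro fps_expansion_intros F(1) G(1))
  hence "\<forall>\<^sub>F u in at 0. \<alpha> u - \<beta> u = 0"
    unfolding \<open>F = G\<close> by (simp add: has_fps_expansion_0_iff eventually_nhds_conv_at)
  hence "\<forall>\<^sub>F x in at s. affine_part A x = affine_part B x"
    unfolding eventually_at_to_0[of _ s] by (simp add: \<alpha>_def \<beta>_def add.commute)
  moreover have "\<forall>\<^sub>F x in at s. A (Some x) \<notin> {None}" "\<forall>\<^sub>F x in at s. B (Some x) \<notin> {None}"
    by (intro eventually_at_if_cofinite cofinite_rational A(1,2) B(1,2); simp)+
  ultimately have "\<forall>\<^sub>F x in at s. A (Some x) = B (Some x)"
    by eventually_elim (auto simp: affine_part_def)
  thus ?thesis by (rule rational_eq_if_eventually_eq[OF A(1) B(1)])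
qed

section \<open>Weights of an orbifold\<close>

definition common_multiple :: "nat \<Rightarrow> (sphere \<Rightarrow> enat) \<Rightarrow> bool" where
  "common_multiple n \<nu> \<longleftrightarrow> n > 0 \<and> (\<forall>z v. \<nu> z = enat v \<longrightarrow> v dvd n)"

definition weight_of :: "nat \<Rightarrow> (sphere \<Rightarrow> enat) \<Rightarrow> sphere \<Rightarrow> nat" where
  "weight_of n \<nu> z = (case \<nu> z of enat v \<Rightarrow> n div v | \<infinity> \<Rightarrow> 0)"

lemma weight_of_eq_iff:
  assumes "common_multiple n \<nu>"
  shows "weight_of n \<nu> z = n \<longleftrightarrow> \<nu> z = 1"
proof (cases "\<nu> z")
  case (enat v)
  hence v: "v dvd n" "n > 0" using assms by (auto simp: common_multiple_def)
  then obtain k where k: "n = v * k" by (auto elim: dvdE)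
  hence "n div v = n \<longleftrightarrow> v = 1" using v(2) by auto
  thus ?thesis by (simp add: weight_of_def enat one_enat_def)
next
  case infinity
  thus ?thesis using assms by (simp add: weight_of_def common_multiple_def)
qed

lemma weight_weight_of:
  assumes "orbifold \<nu>" "common_multiple n \<nu>"
  shows "weight n (weight_of n \<nu>)"
proof -
  have "weight_of n \<nu> z \<le> n" for z by (simp add: weight_of_def split: enat.split)
  moreover have "{z. weight_of n \<nu> z \<noteq> n} = {z. \<nu> z \<noteq> 1}"
    using weight_of_eq_iff[OF assms(2)] by simp
  ultimately show ?thesis
    using assms by (auto simp: weight_def orbifold_def common_multiple_def)
qed

lemma common_multiple_exists:
  assumes "orbifold \<nu>"
  shows "\<exists>n. common_multiple n \<nu>"
proof -
  define P where "P = {z. \<nu> z \<noteq> 1 \<and> \<nu> z \<noteq> \<infinity>}"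
  have fin: "finite P"
    by (rule finite_subset[of _ "{z. \<nu> z \<noteq> 1}"]) (use assms in \<open>auto simp: P_def orbifold_def\<close>)
  define n where "n = (\<Prod>z\<in>P. the_enat (\<nu> z))"
  have "the_enat (\<nu> z) > 0" if "z \<in> P" for z
  proof -
    have "\<nu> z \<ge> 1" "\<nu> z \<noteq> \<infinity>" using assms that by (auto simp: orbifold_def P_def)
    thus ?thesis by (cases "\<nu> z") (auto simp: one_enat_def)
  qed
  hence "n > 0" unfolding n_def by (intro prod_pos) auto
  moreover have "v dvd n" if "\<nu> z = enat v" for z v
  proof (cases "v = 1")
    case False
    hence "z \<in> P" using that by (simp add: P_def one_enat_def)
    hence "the_enat (\<nu> z) dvd n" unfolding n_def using fin by (rule dvd_prodI[rotated])
    thus ?thesis using that by simp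
  qed simp
  ultimately show ?thesis by (auto simp: common_multiple_def)
qed

lemma weight_covering_of_orbifold:
  assumes "orbifold_covering f \<nu> \<nu>" "common_multiple n \<nu>"
  shows "weight_covering (weight_of n \<nu>) f"
proof -
  have f: "rational_function f" "nonconstant f" "\<nu> (f z) = \<nu> z * enat (local_degree f z)" for z
    using assms(1) unfolding orbifold_covering_def by blast+
  have "weight_of n \<nu> z = local_degree f z * weight_of n \<nu> (f z)" for z
  proof -
    have d: "local_degree f z > 0" by (rule local_degree_pos[OF f(1,2)])
    show ?thesis
    proof (cases "\<nu> z")
      case (enat v)
      hence fz: "\<nu> (f z) = enat (v * local_degree f z)" using f(3)[of z] by simp
      hence "v * local_degree f z dvd n" "n > 0" using assms(2) by (auto simp: common_multiple_def)
      then obtain k where k: "n = v * local_degree f z * k" by (auto elim: dvdE)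
      hence "v > 0" using \<open>n > 0\<close> by (cases v) auto
      have "n div v = local_degree f z * k"
        unfolding k using \<open>v > 0\<close> by (simp add: mult.assoc)
      moreover have "n div (v * local_degree f z) = k"
        unfolding k using \<open>v > 0\<close> d by (intro nonzero_mult_div_cancel_left) simp
      ultimately show ?thesis by (simp add: weight_of_def enat fz)
    next
      case infinity
      hence "\<nu> (f z) = \<infinity>" using f(3)[of z] d by (simp add: imult_is_infinity)
      thus ?thesis by (simp add: weight_of_def infinity)
    qed
  qed
  thus ?thesis using f(1,2) unfolding weight_covering_def by blast
qed

section \<open>Euclidean signatures\<close>

text \<open>
The signatures of Euler characteristic zero with at most three exceptional points. In each triple the
first entry is the least common multiple of the finite indices. The signature \<open>(\<infinity>,\<infinity>)\<close> is written with an
additional index \<open>1\<close>, so that every type describes three marked points, which is the number of points that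
Moebius transformations can move freely.
\<close>

definition euclidean_type :: "nat \<Rightarrow> enat \<Rightarrow> enat \<Rightarrow> bool" where
  "euclidean_type n b c \<longleftrightarrow> (n, b, c) \<in>
     {(1, \<infinity>, \<infinity>), (2, enat 2, \<infinity>), (3, enat 3, enat 3), (4, enat 4, enat 2), (6, enat 3, enat 2)}"

definition marked :: "(sphere \<Rightarrow> enat) \<Rightarrow> nat \<Rightarrow> enat \<Rightarrow> enat \<Rightarrow> sphere \<Rightarrow> sphere \<Rightarrow> sphere \<Rightarrow> bool" where
  "marked \<nu> n b c p q r \<longleftrightarrow> distinct [p, q, r] \<and> \<nu> p = enat n \<and> \<nu> q = b \<and> \<nu> r = c \<and>
     (\<forall>z. z \<notin> {p, q, r} \<longrightarrow> \<nu> z = 1)"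

text \<open>
The hypothesis is \<open>1 / a + 1 / b + 1 / c = 1\<close>. The smallest denominator is at most \<open>3\<close>, and this bounds the
next one.
\<close>

lemma egyptian_fractions:
  fixes a b c :: nat
  assumes "a \<ge> b" "b \<ge> c" "c \<ge> 2" and eq: "b * c + a * c + a * b = a * b * c"
  shows "(a, b, c) \<in> {(6, 3, 2), (4, 4, 2), (3, 3, 3)}"
proof -
  have pos: "a * b > 0" "a > 0" using assms by auto
  have "b * c \<le> a * b" using assms by (simp add: mult.commute mult_le_mono)
  moreover have "a * c \<le> a * b" using assms by simp
  ultimately have "(a * b) * c \<le> (a * b) * 3" using eq by linarith
  hence "c \<le> 3" using pos by simp
  hence "c = 2 \<or> c = 3" using assms(3) by linarith
  thus ?thesis
  proof
    assume c: "c = 2"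
    hence e: "2 * b + 2 * a = a * b" using eq by simp
    moreover have "2 * b \<le> 2 * a" using assms by simp
    ultimately have "a * b \<le> a * 4" by linarith
    hence "b \<le> 4" using pos by simp
    hence "b = 2 \<or> b = 3 \<or> b = 4" using assms c by linarith
    thus ?thesis using e c by auto
  next
    assume c: "c = 3"
    hence e: "3 * b + 3 * a = 2 * (a * b)" using eq by simp
    moreover have "3 * b \<le> 3 * a" using assms by simp
    ultimately have "a * b \<le> a * 3" by linarith
    hence "b \<le> 3" using pos by simp
    hence "b = 3" using assms c by linarith
    thus ?thesis using e c by auto
  qed
qed

lemma three_decreasing:
  fixes f :: "'a \<Rightarrow> 'b :: linorder"
  assumes "card S = 3"
  obtains x y z where "S = {x, y, z}" "distinct [x, y, z]" "f x \<ge> f y" "f y \<ge> f z"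
proof -
  obtain u v w where S: "S = {u, v, w}" "u \<noteq> v" "u \<noteq> w" "v \<noteq> w"
    using assms by (auto simp: card_3_iff)
  have "S = {u, w, v}" "S = {v, u, w}" "S = {v, w, u}" "S = {w, u, v}" "S = {w, v, u}"
    using S(1) by auto
  note * = S(1) this
  consider "f u \<ge> f v" "f v \<ge> f w" | "f u \<ge> f w" "f w \<ge> f v" | "f v \<ge> f u" "f u \<ge> f w"
    | "f v \<ge> f w" "f w \<ge> f u" | "f w \<ge> f u" "f u \<ge> f v" | "f w \<ge> f v" "f v \<ge> f u"
    using linorder_linear by metis
  thus ?thesis
  proof cases
    case 1 thus ?thesis using that[of u v w] *(1) S(2-4) by simp
  next
    case 2 thus ?thesis using that[of u w v] *(2) S(2-4) by simp
  next
    case 3 thus ?thesis using that[of v u w] *(3) S(2-4) by simp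
  next
    case 4 thus ?thesis using that[of v w u] *(4) S(2-4) by simp
  next
    case 5 thus ?thesis using that[of w u v] *(5) S(2-4) by simp
  next
    case 6 thus ?thesis using that[of w v u] *(6) S(2-4) by simp
  qed
qed

text \<open>
With \<open>S\<close> the set of exceptional points, \<open>euler_characteristic\<close> says that the numbers \<open>1 - 1 / \<nu> z\<close> for
\<open>z \<in> S\<close> add up to \<open>2\<close>. Each of them lies between \<open>1 / 2\<close> and \<open>1\<close>, so there are two to four exceptional points.
Two of them must have index \<open>\<infinity>\<close>, four of them must have index \<open>2\<close>, and three lead to \<open>egyptian_fractions\<close>
unless an index is infinite.
\<close>

lemma euclidean_classification:
  assumes orb: "orbifold \<nu>" and sig: "signature \<nu> \<noteq> {#2, 2, 2, 2#}"
    and cov: "orbifold_covering f \<nu> \<nu>" and deg: "rat_degree f \<ge> 2"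
  shows "\<exists>n b c p q r. euclidean_type n b c \<and> marked \<nu> n b c p q r"
proof -
  obtain n where n: "common_multiple n \<nu>" using common_multiple_exists[OF orb] by blast
  hence n0: "n > 0" by (simp add: common_multiple_def)
  define j where "j = weight_of n \<nu>"
  define S where "S = {z. \<nu> z \<noteq> 1}"
  have fin: "finite S" using orb by (simp add: orbifold_def S_def)
  have Sj: "{z. j z \<noteq> n} = S"
    unfolding j_def S_def using weight_of_eq_iff[OF n] by simp
  have sum: "(\<Sum>z\<in>S. n - j z) = 2 * n"
    using euler_characteristic[OF weight_weight_of[OF orb n] weight_covering_of_orbifold[OF cov n] deg]
    unfolding j_def[symmetric] Sj .
  have val: "(\<nu> z = \<infinity> \<and> j z = 0) \<or> (\<exists>v. \<nu> z = enat v \<and> v \<ge> 2 \<and> v * j z = n)" if "z \<in> S" for z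
  proof (cases "\<nu> z")
    case (enat v)
    have "\<nu> z \<ge> 1" "\<nu> z \<noteq> 1" using orb that by (auto simp: orbifold_def S_def)
    hence "v \<ge> 2" by (auto simp: enat one_enat_def)
    moreover have "v dvd n" using n enat by (auto simp: common_multiple_def)
    ultimately show ?thesis by (simp add: enat j_def weight_of_def)
  qed (simp add: j_def weight_of_def)
  \<comment> \<open>That is, \<open>1 - 1 / \<nu> z \<ge> 1 / 2\<close>.\<close>
  have half: "2 * j z \<le> n" if "z \<in> S" for z
    using val[OF that] by (auto intro: mult_le_mono1)
  have le: "card S * n \<le> 4 * n"
  proof -
    have "card S * n = (\<Sum>z\<in>S. n)" by simp
    also have "\<dots> \<le> (\<Sum>z\<in>S. 2 * (n - j z))"
    proof (rule sum_mono)
      fix z assume "z \<in> S" thus "n \<le> 2 * (n - j z)" using half[of z] by linarith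
    qed
    also have "\<dots> = 4 * n" using sum by (simp flip: sum_distrib_left)
    finally show ?thesis .
  qed
  have ge: "2 * n \<le> card S * n"
  proof -
    have "2 * n \<le> (\<Sum>z\<in>S. n)" unfolding sum[symmetric] by (rule sum_mono) simp
    thus ?thesis by simp
  qed
  have "2 \<le> card S" "card S \<le> 4" using le ge n0 by simp_all
  hence "card S = 2 \<or> card S = 3 \<or> card S = 4" by linarith
  thus ?thesis
  proof (elim disjE)
    assume "card S = 2"
    then obtain x y where S: "S = {x, y}" "x \<noteq> y" by (auto simp: card_2_iff)
    have "n - j x + (n - j y) = 2 * n" using sum S by simp
    hence "j x = 0" "j y = 0" using n0 by linarith+
    hence inf: "\<nu> x = \<infinity>" "\<nu> y = \<infinity>"
      using val[of x] val[of y] S n0 by auto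
    have "infinite (UNIV :: sphere set)"
      using infinite_UNIV_char_0[where 'a = complex] by (simp add: finite_option_UNIV)
    then obtain z where z: "z \<notin> {x, y}" using ex_new_if_finite[of "{x, y}"] by blast
    have one: "\<nu> w = 1" if "w \<notin> {x, y}" for w using that S(1) by (auto simp: S_def)
    have "marked \<nu> 1 \<infinity> \<infinity> z x y"
      unfolding marked_def using one[OF z] one inf z S(2) by (auto simp: one_enat_def)
    moreover have "euclidean_type 1 \<infinity> \<infinity>" by (simp add: euclidean_type_def)
    ultimately show ?thesis by blast
  next
    assume "card S = 4"
    have "(\<Sum>z\<in>S. n - 2 * j z) = 0"
    proof -
      have "(\<Sum>z\<in>S. n - 2 * j z) + (\<Sum>z\<in>S. n) = (\<Sum>z\<in>S. 2 * (n - j z))"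
        unfolding sum.distrib[symmetric]
      proof (rule sum.cong[OF refl])
        fix z assume "z \<in> S" thus "n - 2 * j z + n = 2 * (n - j z)" using half[of z] by linarith
      qed
      also have "\<dots> = 4 * n" using sum by (simp flip: sum_distrib_left)
      finally show ?thesis using \<open>card S = 4\<close> by simp
    qed
    hence "n - 2 * j z = 0" if "z \<in> S" for z using that fin by simp
    hence two: "2 * j z = n" if "z \<in> S" for z using that half[of z] by fastforce
    have "\<nu> z = 2" if z: "z \<in> S" for z
    proof -
      have "j z > 0" using two[OF z] n0 by linarith
      then obtain v where "\<nu> z = enat v" "v * j z = 2 * j z" using val[OF z] two[OF z] by auto
      thus ?thesis using \<open>j z > 0\<close> by (simp add: numeral_eq_enat)
    qed
    hence "image_mset \<nu> (mset_set S) = image_mset (\<lambda>_. 2) (mset_set S)"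
      using fin by (intro image_mset_cong) simp
    also have "\<dots> = {#2, 2, 2, 2#}"
      using \<open>card S = 4\<close> by (simp add: image_mset_const_eq numeral_eq_Suc)
    also have "S = {z. \<nu> z > 1}"
      using orb by (auto simp: S_def orbifold_def order.strict_iff_order)
    finally have "signature \<nu> = {#2, 2, 2, 2#}" by (simp add: signature_def)
    with sig show ?thesis by blast
  next
    assume "card S = 3"
    then obtain x y z where S: "S = {x, y, z}" "distinct [x, y, z]" and le: "\<nu> x \<ge> \<nu> y" "\<nu> y \<ge> \<nu> z"
      using three_decreasing[of S \<nu>] by metis
    have xyz: "x \<in> S" "y \<in> S" "z \<in> S" using S(1) by auto
    have one: "\<nu> w = 1" if "w \<notin> {x, y, z}" for w using that S(1) by (auto simp: S_def)
    have "n - j x + (n - j y) + (n - j z) = 2 * n" using sum S by simp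
    hence js: "j x + j y + j z = n" using half[OF xyz(1)] half[OF xyz(2)] half[OF xyz(3)] by linarith
    show ?thesis
    proof (cases "\<nu> x")
      case infinity
      hence jx: "j x = 0" using val[OF xyz(1)] by auto
      hence jyz: "2 * j y = n" "2 * j z = n" using js half[OF xyz(2)] half[OF xyz(3)] by linarith+
      have "\<nu> w = enat 2" if w: "w \<in> S" "2 * j w = n" for w
      proof -
        have "j w > 0" using w n0 by linarith
        then obtain v where "\<nu> w = enat v" "v * j w = 2 * j w" using val[OF w(1)] w(2) by auto
        thus ?thesis using \<open>j w > 0\<close> by simp
      qed
      hence "\<nu> y = enat 2" "\<nu> z = enat 2" using jyz xyz by blast+
      hence "marked \<nu> 2 (enat 2) \<infinity> y z x"
        using S(2) infinity one unfolding marked_def by auto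
      moreover have "euclidean_type 2 (enat 2) \<infinity>" by (simp add: euclidean_type_def)
      ultimately show ?thesis by blast
    next
      case (enat a)
      obtain b c where bc: "\<nu> y = enat b" "\<nu> z = enat c" using le enat
        by (metis enat_ile)
      have v: "a * j x = n" "b * j y = n" "c * j z = n" "a \<ge> 2" "b \<ge> 2" "c \<ge> 2"
        using val[OF xyz(1)] val[OF xyz(2)] val[OF xyz(3)] enat bc by auto
      have "n * (b * c + a * c + a * b) = (a * j x) * (b * c) + (b * j y) * (a * c) + (c * j z) * (a * b)"
        unfolding v(1-3) by (simp add: algebra_simps)
      also have "\<dots> = (j x + j y + j z) * (a * b * c)" by (simp add: algebra_simps)
      also have "\<dots> = n * (a * b * c)" by (simp only: js)
      finally have "b * c + a * c + a * b = a * b * c" using n0 by simp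
      hence abc: "(a, b, c) \<in> {(6, 3, 2), (4, 4, 2), (3, 3, 3)}"
        using le enat bc v by (intro egyptian_fractions) auto
      have "marked \<nu> a (enat b) (enat c) x y z"
        using S(2) enat bc one unfolding marked_def by auto
      moreover have "euclidean_type a (enat b) (enat c)" using abc by (auto simp: euclidean_type_def)
      ultimately show ?thesis by blast
    qed
  qed
qed

text \<open>
Every point of index \<open>n\<close> can serve as the first marked point. For \<open>n = 1\<close> this concerns infinitely many
points, for the other types only the exceptional ones.
\<close>

lemma marked_permute:
  assumes "euclidean_type n b c" "marked \<nu> n b c p q r" "\<nu> s = enat n"
  shows "\<exists>q' r'. marked \<nu> n b c s q' r'"
proof -
  note m = assms(2)[unfolded marked_def]
  have *: "s = p \<or> s = q \<or> s = r \<or> s \<notin> {p, q, r}" by auto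
  from assms(1) consider "n = 1" "b = \<infinity>" "c = \<infinity>" | "n = 2" "b = enat 2" "c = \<infinity>"
    | "n = 3" "b = enat 3" "c = enat 3" | "n = 4" "b = enat 4" "c = enat 2"
    | "n = 6" "b = enat 3" "c = enat 2"
    by (auto simp: euclidean_type_def)
  thus ?thesis
  proof cases
    case 1
    hence "s \<noteq> q" "s \<noteq> r" using m assms(3) by auto
    hence "marked \<nu> n b c s q r"
      using m assms(3) 1 unfolding marked_def by (auto simp: one_enat_def)
    thus ?thesis by blast
  next
    case 2
    hence "s = p \<or> s = q" using m assms(3) * by (auto simp: one_enat_def)
    moreover have "marked \<nu> n b c q p r" using m 2 unfolding marked_def by auto
    ultimately show ?thesis using assms(2) by auto
  next
    case 3
    hence "s = p \<or> s = q \<or> s = r" using m assms(3) * by (auto simp: one_enat_def)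
    moreover have "marked \<nu> n b c q p r" "marked \<nu> n b c r p q"
      using m 3 unfolding marked_def by auto
    ultimately show ?thesis using assms(2) by auto
  next
    case 4
    hence "s = p \<or> s = q" using m assms(3) * by (auto simp: one_enat_def)
    moreover have "marked \<nu> n b c q p r" using m 4 unfolding marked_def by auto
    ultimately show ?thesis using assms(2) by auto
  next
    case 5
    hence "s = p" using m assms(3) * by (auto simp: one_enat_def)
    thus ?thesis using assms(2) by auto
  qed
qed

text \<open>
For \<open>n = 1\<close> the second marked point has index \<open>\<infinity>\<close>, so it cannot be a point of index \<open>n\<close>.
\<close>

lemma marked_permute_two:
  assumes "euclidean_type n b c" "n \<noteq> 1" "marked \<nu> n b c p q r"
    and "\<nu> s = enat n" "\<nu> t = enat n" "s \<noteq> t"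
  shows "\<exists>r'. marked \<nu> n b c s t r'"
proof -
  obtain q' r' where m': "marked \<nu> n b c s q' r'"
    using marked_permute[OF assms(1,3,4)] by blast
  note m = m'[unfolded marked_def]
  have *: "t = q' \<or> t = r'"
    using m assms by (cases "t \<in> {q', r'}") (auto simp: one_enat_def)
  have "t = q' \<or> marked \<nu> n b c s r' q'"
    using assms(1) m * assms(2,4-6) unfolding marked_def euclidean_type_def
    by auto
  thus ?thesis using m' * by auto
qed

text \<open>
Among the indices of a Euclidean type, \<open>n\<close> has no finite multiple other than itself.
\<close>

lemma covering_preserves_maximal_index:
  assumes type: "euclidean_type n b c" and m: "marked \<nu>' n b c p q r"
    and cov: "orbifold_covering f \<nu> \<nu>'" and s: "\<nu> s = enat n"
  shows "\<nu>' (f s) = enat n"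
proof -
  have d: "local_degree f s > 0"
    using cov local_degree_pos by (auto simp: orbifold_covering_def)
  have fs: "\<nu>' (f s) = enat (n * local_degree f s)"
    using cov s by (simp add: orbifold_covering_def)
  have "\<nu>' (f s) \<in> {enat n, b, c, enat 1}"
    using m by (auto simp: marked_def one_enat_def)
  thus ?thesis using type fs d by (auto simp: euclidean_type_def)
qed

text \<open>
Under a covering the index of the image of a point is a positive multiple of the index of the point, with
\<open>\<infinity>\<close> as a multiple of everything.
\<close>

definition multiple_in :: "enat \<Rightarrow> enat set \<Rightarrow> bool" where
  "multiple_in v V \<longleftrightarrow> (\<exists>d>0. v * enat d \<in> V)"

lemma covering_multiple_in:
  assumes "marked \<nu> n b c p q r" "marked \<nu>' n' b' c' p' q' r'" "orbifold_covering f \<nu> \<nu>'"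
  shows "multiple_in (enat n) {enat n', b', c', enat 1}"
    "multiple_in b {enat n', b', c', enat 1}" "multiple_in c {enat n', b', c', enat 1}"
proof -
  have "multiple_in (\<nu> z) {enat n', b', c', enat 1}" for z
  proof -
    have "local_degree f z > 0" "\<nu>' (f z) = \<nu> z * enat (local_degree f z)"
      using assms(3) local_degree_pos by (auto simp: orbifold_covering_def)
    moreover have "\<nu>' (f z) \<in> {enat n', b', c', enat 1}"
      using assms(2) by (auto simp: marked_def one_enat_def)
    ultimately show ?thesis by (auto simp: multiple_in_def)
  qed
  from this[of p] this[of q] this[of r]
  show "multiple_in (enat n) {enat n', b', c', enat 1}"
    "multiple_in b {enat n', b', c', enat 1}" "multiple_in c {enat n', b', c', enat 1}"
    using assms(1) by (simp_all add: marked_def)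
qed

lemma multiple_in_enat:
  "multiple_in (enat v) V \<longleftrightarrow> (\<exists>d>0. enat (v * d) \<in> V)"
  by (simp add: multiple_in_def)

lemma multiple_in_infinity: "multiple_in \<infinity> V \<longleftrightarrow> \<infinity> \<in> V"
  by (auto simp: multiple_in_def imult_is_infinity)

text \<open>
Every index of one orbifold has a positive multiple among the indices of the other one, in both directions.
This separates the five types.
\<close>

lemma euclidean_type_unique:
  assumes "euclidean_type n b c" "euclidean_type n' b' c'"
    and "marked \<nu> n b c p q r" "marked \<nu>' n' b' c' p' q' r'"
    and "orbifold_covering f \<nu> \<nu>'" "orbifold_covering g \<nu>' \<nu>"
  shows "n' = n \<and> b' = b \<and> c' = c"
proof -
  note * = covering_multiple_in[OF assms(3,4,5)] covering_multiple_in[OF assms(4,3,6)]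
  have dvd: "a dvd k" if "a * d = k" for a d k :: nat using that by auto
  show ?thesis
    using assms(1,2) * unfolding euclidean_type_def
    by (elim insertE emptyE; auto simp: multiple_in_enat multiple_in_infinity dest!: dvd)
qed

section \<open>The intermediate orbifold\<close>

lemma enat_mult_right_cancel:
  assumes "x * enat k = y * enat k" "k > 0"
  shows "x = y"
  using assms by (cases x; cases y) (auto simp: imult_is_infinity)

text \<open>
The definition of \<open>\<nu>'\<close> is forced by the requirement that \<open>X\<close> be a covering onto \<open>O\<close>, and the division is exact
because \<open>Y\<close> is surjective and \<open>X \<circ> Y\<close> is a covering. That \<open>B\<close> is a covering follows by comparing the local
degrees of the two sides of \<open>A \<circ> X = X \<circ> B\<close> and cancelling the local degree of \<open>X\<close> at \<open>B w\<close>.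
\<close>

lemma intermediate_orbifold:
  assumes orb: "orbifold \<nu>" and A: "orbifold_covering A \<nu> \<nu>" and XY: "orbifold_covering (X \<circ> Y) \<nu> \<nu>"
    and X: "rational_function X" "nonconstant X" and Y: "rational_function Y" "nonconstant Y"
    and B: "rational_function B" "nonconstant B" and eq: "A \<circ> X = X \<circ> B"
  obtains \<nu>' where "orbifold \<nu>'" "orbifold_covering Y \<nu> \<nu>'" "orbifold_covering X \<nu>' \<nu>"
    "orbifold_covering B \<nu>' \<nu>'"
proof -
  \<comment> \<open>The natural number division is exact, as the equations for \<open>\<nu> (X (Y z))\<close> below show.\<close>
  define \<nu>' where "\<nu>' = (\<lambda>w. case \<nu> (X w) of enat v \<Rightarrow> enat (v div local_degree X w) | \<infinity> \<Rightarrow> \<infinity>)"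
  have dX: "local_degree X w > 0" for w by (rule local_degree_pos[OF X])
  have dY: "local_degree Y z > 0" for z by (rule local_degree_pos[OF Y])
  have XYz: "\<nu> (X (Y z)) = \<nu> z * enat (local_degree X (Y z) * local_degree Y z)" for z
    using XY local_degree_compose[OF X Y, of z] by (simp add: orbifold_covering_def)
  have Yz: "\<nu>' (Y z) = \<nu> z * enat (local_degree Y z)" for z
  proof (cases "\<nu> z")
    case (enat v)
    have "\<nu> (X (Y z)) = enat (local_degree X (Y z) * (v * local_degree Y z))"
      using XYz[of z] by (simp add: enat mult_ac)
    thus ?thesis using dX[of "Y z"] by (simp add: \<nu>'_def enat)
  next
    case infinity
    hence "\<nu> (X (Y z)) = \<infinity>" using XYz[of z] dX[of "Y z"] dY[of z] by (simp add: imult_is_infinity)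
    thus ?thesis using infinity dY[of z] by (simp add: \<nu>'_def imult_is_infinity)
  qed
  have Xw: "\<nu> (X w) = \<nu>' w * enat (local_degree X w)" for w
  proof -
    obtain z where z: "w = Y z" using rational_surj[OF Y, of w] by metis
    show ?thesis unfolding z Yz XYz
      by (simp add: mult.assoc mult.commute[of "local_degree X _"])
  qed
  have ge1: "\<nu>' w \<ge> 1" for w
  proof -
    obtain z where z: "w = Y z" using rational_surj[OF Y, of w] by metis
    have "\<nu> z \<ge> 1" using orb by (simp add: orbifold_def)
    moreover have "1 \<le> enat (local_degree Y z)" using dY[of z] by (simp add: one_enat_def)
    ultimately show ?thesis unfolding z Yz
      by (metis mult_mono' mult_1 zero_le)
  qed
  have "\<nu>' w = 1" if "\<nu> (X w) = 1" for w
    using Xw[of w] that ge1[of w] by (cases "\<nu>' w") (auto simp: one_enat_def imult_is_infinity dX)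
  hence "{w. \<nu>' w \<noteq> 1} \<subseteq> X -` {z. \<nu> z \<noteq> 1}" by auto
  moreover have "finite (X -` {z. \<nu> z \<noteq> 1})"
    using finite_vimage_rational[OF X, of "{z. \<nu> z \<noteq> 1}"] orb unfolding orbifold_def by blast
  ultimately have orb': "orbifold \<nu>'"
    using ge1 finite_subset unfolding orbifold_def by blast
  have rA: "rational_function A" "nonconstant A" and Az: "\<nu> (A z) = \<nu> z * enat (local_degree A z)" for z
    using A unfolding orbifold_covering_def by blast+
  have Bw: "\<nu>' (B w) = \<nu>' w * enat (local_degree B w)" for w
  proof -
    have "\<nu>' (B w) * enat (local_degree X (B w)) = \<nu> (A (X w))"
      using Xw[of "B w"] fun_cong[OF eq, of w] by simp
    also have "\<dots> = \<nu>' w * enat (local_degree A (X w) * local_degree X w)"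
      unfolding Az Xw by (simp add: mult.assoc mult.commute[of "local_degree X _"])
    also have "local_degree A (X w) * local_degree X w = local_degree X (B w) * local_degree B w"
      using local_degree_compose[OF rA X, of w] local_degree_compose[OF X B, of w] eq by simp
    also have "\<nu>' w * enat (local_degree X (B w) * local_degree B w)
        = (\<nu>' w * enat (local_degree B w)) * enat (local_degree X (B w))"
      by (simp add: mult.assoc mult.commute[of "local_degree X _"])
    finally show ?thesis using enat_mult_right_cancel dX by blast
  qed
  show ?thesis
  proof (rule that[OF orb'])
    show "orbifold_covering Y \<nu> \<nu>'" "orbifold_covering X \<nu>' \<nu>" "orbifold_covering B \<nu>' \<nu>'"
      unfolding orbifold_covering_def using X Y B Xw Yz Bw by blast+
  qed
qed

text \<open>
An orbifold of signature \<open>(2,2,2,2)\<close> has only the indices \<open>1\<close> and \<open>2\<close>, whereas every type of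
\<open>euclidean_type\<close> contains an index with no positive multiple among them.
\<close>

lemma signature_2222_not_covered:
  assumes "orbifold \<nu>'" "orbifold_covering f \<nu> \<nu>'"
    and "euclidean_type n b c" "marked \<nu> n b c p q r"
  shows "signature \<nu>' \<noteq> {#2, 2, 2, 2#}"
proof
  assume sig: "signature \<nu>' = {#2, 2, 2, 2#}"
  have small: "\<nu>' w \<in> {enat 1, enat 2}" for w
  proof (cases "\<nu>' w = 1")
    case False
    have fin: "finite {z. \<nu>' z > 1}"
      by (rule finite_subset[of _ "{z. \<nu>' z \<noteq> 1}"]) (use assms(1) in \<open>auto simp: orbifold_def\<close>)
    have "\<nu>' w > 1" using False assms(1) by (simp add: orbifold_def order.strict_iff_order)
    hence "\<nu>' w \<in># signature \<nu>'" using fin by (simp add: signature_def)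
    thus ?thesis unfolding sig by (auto simp: numeral_eq_enat)
  qed (simp add: one_enat_def)
  have "multiple_in (\<nu> z) {enat 1, enat 2}" for z
  proof -
    have "local_degree f z > 0" "\<nu>' (f z) = \<nu> z * enat (local_degree f z)"
      using assms(2) local_degree_pos by (auto simp: orbifold_covering_def)
    thus ?thesis using small[of "f z"] unfolding multiple_in_def by metis
  qed
  from this[of p] this[of r]
  have mult: "multiple_in (enat n) {enat 1, enat 2}" "multiple_in c {enat 1, enat 2}"
    using assms(4) by (simp_all add: marked_def)
  have "c \<noteq> \<infinity>"
  proof
    assume "c = \<infinity>"
    with mult(2) show False by (simp add: multiple_in_infinity)
  qed
  obtain d where "d > 0" "n * d = 1 \<or> n * d = 2"
    using mult(1) unfolding multiple_in_enat by auto
  hence "n * d \<le> 2" "n \<le> n * d" by auto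
  hence "n \<le> 2" by linarith
  thus False using assms(3) \<open>c \<noteq> \<infinity>\<close> by (auto simp: euclidean_type_def)
qed

section \<open>Rigidity\<close>

text \<open>
Both orbifolds are moved to one standard orbifold with marked points \<open>0\<close>, \<open>1\<close> and \<open>-1\<close>; keeping them finite
makes infinity an ordinary point. There \<open>A\<close> and \<open>B\<close> become coverings with equal multipliers that agree at \<open>0\<close>,
where their common value has index \<open>n\<close>. So they are equal, and the two changes of coordinates conjugate \<open>B\<close>
to \<open>A\<close>.
\<close>

lemma conjugate_if_matching_points:
  assumes type: "euclidean_type n b c"
    and m: "marked \<nu> n b c p q r" "marked \<nu>' n b c p' q' r'"
    and cov: "orbifold_covering A \<nu> \<nu>" "orbifold_covering B \<nu>' \<nu>'" "orbifold_covering Y \<nu> \<nu>'"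
    and eq: "B \<circ> Y = Y \<circ> A"
    and pt: "(A p = p \<and> B p' = p') \<or> (A p = q \<and> B p' = q' \<and> b = enat n)"
  shows "conjugate B A"
proof -
  define x\<^sub>0 x\<^sub>1 x\<^sub>2 :: sphere where "x\<^sub>0 = Some 0" and "x\<^sub>1 = Some 1" and "x\<^sub>2 = Some (-1)"
  define \<nu>\<^sub>0 where "\<nu>\<^sub>0 = (\<lambda>z. if z = x\<^sub>0 then enat n else if z = x\<^sub>1 then b else if z = x\<^sub>2 then c else 1)"
  have dist: "distinct [x\<^sub>0, x\<^sub>1, x\<^sub>2]" by (simp add: x\<^sub>0_def x\<^sub>1_def x\<^sub>2_def)
  have normalise: "\<exists>f f'. invertible_rational f \<and> invertible_rational f' \<and> f \<circ> f' = id \<and> f' \<circ> f = id \<and>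
      f p = x\<^sub>0 \<and> f q = x\<^sub>1 \<and> orbifold_covering f \<nu> \<nu>\<^sub>0 \<and> orbifold_covering f' \<nu>\<^sub>0 \<nu>"
    if mk: "marked \<nu> n b c p q r" for \<nu> p q r
  proof -
    have "distinct [p, q, r]" using mk by (simp add: marked_def)
    then obtain f where f: "invertible_rational f" "f p = x\<^sub>0" "f q = x\<^sub>1" "f r = x\<^sub>2"
      using moebius_triple[OF _ dist] by blast
    obtain f' where f': "invertible_rational f'" "f \<circ> f' = id" "f' \<circ> f = id"
      using f(1) by (rule invertible_rationalE)
    have ff: "f (f' z) = z" "f' (f z) = z" for z using f' by (metis comp_apply id_apply)+
    have "\<nu>\<^sub>0 (f z) = \<nu> z" for z
    proof (cases "z \<in> {p, q, r}")
      case True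
      thus ?thesis using f dist mk by (auto simp: \<nu>\<^sub>0_def marked_def)
    next
      case False
      hence "f z \<notin> {x\<^sub>0, x\<^sub>1, x\<^sub>2}" using f ff(2) by (metis insertE insertI1 insertI2 emptyE)
      thus ?thesis using False mk by (auto simp: \<nu>\<^sub>0_def marked_def)
    qed
    hence "orbifold_covering f \<nu> \<nu>\<^sub>0" "orbifold_covering f' \<nu>\<^sub>0 \<nu>"
      using f(1) f'(1) ff by (metis orbifold_covering_invertible)+
    thus ?thesis using f f' by blast
  qed
  obtain f f' where f: "invertible_rational f" "invertible_rational f'" "f \<circ> f' = id" "f' \<circ> f = id"
    "f p = x\<^sub>0" "f q = x\<^sub>1" "orbifold_covering f \<nu> \<nu>\<^sub>0" "orbifold_covering f' \<nu>\<^sub>0 \<nu>"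
    using normalise[OF m(1)] by blast
  obtain g g' where g: "invertible_rational g" "invertible_rational g'" "g \<circ> g' = id" "g' \<circ> g = id"
    "g p' = x\<^sub>0" "g q' = x\<^sub>1" "orbifold_covering g \<nu>' \<nu>\<^sub>0" "orbifold_covering g' \<nu>\<^sub>0 \<nu>'"
    using normalise[OF m(2)] by blast
  have ff: "f (f' z) = z" "f' (f z) = z" for z using f(3,4) by (metis comp_apply id_apply)+
  have gg: "g (g' z) = z" "g' (g z) = z" for z using g(3,4) by (metis comp_apply id_apply)+
  define A\<^sub>0 where "A\<^sub>0 = f \<circ> (A \<circ> f')"
  define B\<^sub>0 where "B\<^sub>0 = g \<circ> (B \<circ> g')"
  define Y\<^sub>0 where "Y\<^sub>0 = g \<circ> (Y \<circ> f')"
  have cov0: "orbifold_covering A\<^sub>0 \<nu>\<^sub>0 \<nu>\<^sub>0" "orbifold_covering B\<^sub>0 \<nu>\<^sub>0 \<nu>\<^sub>0" "orbifold_covering Y\<^sub>0 \<nu>\<^sub>0 \<nu>\<^sub>0"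
    unfolding A\<^sub>0_def B\<^sub>0_def Y\<^sub>0_def using orbifold_covering_compose cov f(7,8) g(7,8) by blast+
  have eq0: "B\<^sub>0 \<circ> Y\<^sub>0 = Y\<^sub>0 \<circ> A\<^sub>0"
    using fun_cong[OF eq] by (auto simp: fun_eq_iff A\<^sub>0_def B\<^sub>0_def Y\<^sub>0_def ff gg)
  define j where "j = weight_of n \<nu>\<^sub>0"
  have orb: "orbifold \<nu>\<^sub>0"
  proof -
    have "{z. \<nu>\<^sub>0 z \<noteq> 1} \<subseteq> {x\<^sub>0, x\<^sub>1, x\<^sub>2}" by (auto simp: \<nu>\<^sub>0_def)
    hence "finite {z. \<nu>\<^sub>0 z \<noteq> 1}" by (rule finite_subset) simp
    moreover have "\<nu>\<^sub>0 z \<ge> 1" for z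
      using type by (auto simp: \<nu>\<^sub>0_def euclidean_type_def one_enat_def)
    ultimately show ?thesis by (simp add: orbifold_def)
  qed
  have cm: "common_multiple n \<nu>\<^sub>0"
    using type unfolding common_multiple_def \<nu>\<^sub>0_def euclidean_type_def
    by (auto simp: one_enat_def split: if_splits)
  have n: "n > 0" using cm by (simp add: common_multiple_def)
  have w: "weight n j" unfolding j_def by (rule weight_weight_of[OF orb cm])
  have jinf: "j None = n"
    by (simp add: j_def weight_of_def \<nu>\<^sub>0_def x\<^sub>0_def x\<^sub>1_def x\<^sub>2_def one_enat_def)
  have jx: "j x\<^sub>0 = 1" "j x\<^sub>1 = (case b of enat v \<Rightarrow> n div v | \<infinity> \<Rightarrow> 0)"
    "j x\<^sub>2 = (case c of enat v \<Rightarrow> n div v | \<infinity> \<Rightarrow> 0)"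
    using dist n by (auto simp: j_def weight_of_def \<nu>\<^sub>0_def)
  have flat: "(\<Sum>s\<in>cone_points n j. n - j (Some s)) = 2 * n"
  proof -
    have "j (Some s) = n" if "s \<notin> {0, 1, -1}" for s
      using that by (simp add: j_def weight_of_def \<nu>\<^sub>0_def x\<^sub>0_def x\<^sub>1_def x\<^sub>2_def one_enat_def)
    hence "(\<Sum>s\<in>cone_points n j. n - j (Some s)) = (\<Sum>s\<in>{0, 1, -1}. n - j (Some s))"
      by (intro sum.mono_neutral_left) (auto simp: cone_points_def)
    also have "\<dots> = (n - j x\<^sub>0) + (n - j x\<^sub>1) + (n - j x\<^sub>2)"
      by (simp add: x\<^sub>0_def x\<^sub>1_def x\<^sub>2_def)
    also have "\<dots> = 2 * n" using type unfolding jx euclidean_type_def by auto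
    finally show ?thesis .
  qed
  note wc = weight_covering_of_orbifold[OF _ cm, folded j_def]
  obtain a where a: "a \<noteq> 0" "multiplier n j A\<^sub>0 a" "multiplier n j B\<^sub>0 a"
    using equal_multipliers_if_semiconjugate[OF w jinf flat wc[OF cov0(1)] wc[OF cov0(2)] wc[OF cov0(3)] eq0]
    by blast
  have "\<exists>t. A\<^sub>0 (Some 0) = Some t \<and> B\<^sub>0 (Some 0) = Some t \<and> j (Some t) = 1"
  proof -
    have base: "A\<^sub>0 (Some 0) = f (A p)" "B\<^sub>0 (Some 0) = g (B p')"
      using f(5) g(5) ff(2)[of p] gg(2)[of p'] by (simp_all add: A\<^sub>0_def B\<^sub>0_def x\<^sub>0_def)
    from pt show ?thesis
    proof
      assume "A p = p \<and> B p' = p'"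
      thus ?thesis using base f(5) g(5) jx(1) by (auto simp: x\<^sub>0_def)
    next
      assume *: "A p = q \<and> B p' = q' \<and> b = enat n"
      hence "j x\<^sub>1 = 1" using jx(2) n by simp
      thus ?thesis using * base f(6) g(6) by (auto simp: x\<^sub>1_def)
    qed
  qed
  then obtain t where t: "A\<^sub>0 (Some 0) = Some t" "B\<^sub>0 (Some 0) = Some t" "j (Some t) = 1" by blast
  have "A\<^sub>0 = B\<^sub>0"
    by (rule covering_determined_by_multiplier[OF w weight_coveringD(1,2)[OF wc[OF cov0(1)]] a(2) t(1)
          weight_coveringD(1,2)[OF wc[OF cov0(2)]] a(3) t(2) a(1) t(3)])
  have "(A \<circ> (f' \<circ> g)) z = ((f' \<circ> g) \<circ> B) z" for z
  proof -
    have "f (A (f' (g z))) = g (B (g' (g z)))"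
      using fun_cong[OF \<open>A\<^sub>0 = B\<^sub>0\<close>, of "g z"] by (simp add: A\<^sub>0_def B\<^sub>0_def)
    thus ?thesis using ff(2) gg(2) by (metis comp_apply)
  qed
  hence "A \<circ> (f' \<circ> g) = (f' \<circ> g) \<circ> B" by blast
  thus ?thesis
    using invertible_rational_compose[OF f(2) g(1)] unfolding conjugate_def by blast
qed

text \<open>
Move the two points of index \<open>\<infinity>\<close> to \<open>0\<close> and \<open>\<infinity>\<close>. The covering condition says that \<open>A\<close> maps only these two
points to \<open>{0, \<infinity>}\<close>, so \<open>A = u / v\<close> where one of \<open>u\<close>, \<open>v\<close> is constant and the other one vanishes at most
at \<open>0\<close>. As the degree is at least two, the fixed point equation \<open>u = z v\<close> has a solution \<open>z \<noteq> 0\<close>.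
\<close>

lemma regular_fixed_point:
  assumes A: "orbifold_covering A \<nu> \<nu>" and deg: "rat_degree A \<ge> 2"
    and m: "marked \<nu> 1 \<infinity> \<infinity> s q r"
  shows "\<exists>x. \<nu> x = 1 \<and> A x = x"
proof -
  have rA: "rational_function A" "nonconstant A" and Az: "\<nu> (A z) = \<nu> z * enat (local_degree A z)" for z
    using A unfolding orbifold_covering_def by blast+
  have "distinct [q, r, s]" using m by (auto simp: marked_def)
  then obtain f where f: "invertible_rational f" "f q = None" "f r = Some 0"
    using moebius_to_standard by blast
  obtain f' where f': "invertible_rational f'" "f \<circ> f' = id" "f' \<circ> f = id"
    using f(1) by (rule invertible_rationalE)
  have ff: "f (f' z) = z" "f' (f z) = z" for z using f' by (metis comp_apply id_apply)+
  have one: "\<nu> z = 1" if "z \<noteq> q" "z \<noteq> r" for z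
    using m that by (cases "z = s") (auto simp: marked_def one_enat_def)
  have inf: "\<nu> z = \<infinity> \<longleftrightarrow> z = q \<or> z = r" for z
    using m one[of z] by (cases "z = q \<or> z = r") (auto simp: marked_def one_enat_def)
  have fi: "f' None = q" "f' (Some 0) = r" using f(2,3) ff(2) by metis+
  define g where "g = f \<circ> A \<circ> f'"
  note g = moebius_conjugate[OF f(1) f'(1) rA, folded g_def]
  have pre: "z = 0" if "g (Some z) \<in> {None, Some 0}" for z
  proof -
    define w where "w = f' (Some z)"
    have "A w = f' (g (Some z))" by (simp add: w_def g_def ff)
    hence "A w = q \<or> A w = r" using that fi by auto
    hence "\<nu> w * enat (local_degree A w) = \<infinity>" using inf[of "A w"] Az[of w] by simp
    hence "\<nu> w = \<infinity>" by (auto simp: imult_is_infinity)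
    hence "f w = None \<or> f w = Some 0" using inf[of w] f(2,3) by auto
    thus "z = 0" by (simp add: w_def ff)
  qed
  obtain u v where uv: "represents u v g" using g(1) by (auto simp: rational_function_def)
  have v: "v \<noteq> 0" using uv by (simp add: represents_def)
  have d: "max (degree u) (degree v) \<ge> 2" using rat_degree_eq[OF uv] g(3) deg by simp
  have roots: "z = 0" if "poly u z = 0 \<or> poly v z = 0" for z
    using that pre[of z] by (auto simp: represents_finite[OF uv] proj_def)
  have const: "degree h = 0" if "poly h 0 \<noteq> 0" "\<And>z. poly h z = 0 \<Longrightarrow> z = 0" for h :: "complex poly"
    using that alg_closed_imp_poly_has_root[of h] by auto
  have "\<exists>z. z \<noteq> 0 \<and> poly u z = z * poly v z"
  proof (cases "poly u 0 = 0")
    case False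
    have "degree u = 0" using const[OF False] roots by blast
    hence "degree v \<ge> 2" using d by simp
    hence "degree (u - [:0, 1:] * v) > 0"
    proof -
      define t where "t = [:0, 1:] * v"
      have "degree t = Suc (degree v)" using v by (simp add: t_def degree_mult_eq)
      moreover from this have "degree (- t + u) = degree (- t)"
        using \<open>degree u = 0\<close> by (intro degree_add_eq_left) simp
      ultimately have "degree (u - t) > 0" by simp
      thus ?thesis unfolding t_def .
    qed
    then obtain z where z: "poly (u - [:0, 1:] * v) z = 0" using alg_closed_imp_poly_has_root by blast
    hence "z \<noteq> 0" using False by auto
    thus ?thesis using z by auto
  next
    case True
    have "poly v 0 \<noteq> 0" using True represents_no_common_root[OF uv, of 0] by simp
    hence "degree v = 0" using const[of v] roots by blast
    then obtain k where k: "v = [:k:]" by (auto elim: degree_eq_zeroE)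
    have "k \<noteq> 0" using v k by simp
    obtain h where h: "u = [:0, 1:] * h" using True poly_eq_0_iff_dvd[of u 0] by (auto elim: dvdE)
    have "h \<noteq> 0" using d h \<open>degree v = 0\<close> by auto
    hence "degree u = Suc (degree h)" unfolding h by (simp add: degree_mult_eq)
    hence dh: "degree h > 0" using d \<open>degree v = 0\<close> by simp
    have "degree (- v + h) = degree h"
      using dh \<open>degree v = 0\<close> by (intro degree_add_eq_right) simp
    hence "degree (h - v) > 0" using dh by simp
    then obtain z where z: "poly (h - v) z = 0" using alg_closed_imp_poly_has_root by blast
    obtain y where y: "poly h y = 0" using alg_closed_imp_poly_has_root[OF dh] by blast
    hence "y = 0" using roots[of y] by (simp add: h)
    hence "z \<noteq> 0" using z y \<open>k \<noteq> 0\<close> by (auto simp: k)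
    thus ?thesis using z by (auto simp: h)
  qed
  then obtain z where z: "z \<noteq> 0" "poly u z = z * poly v z" by blast
  have "g (Some z) = Some z"
    using z roots[of z] by (auto simp: represents_finite[OF uv] proj_def)
  hence fix_pt: "A (f' (Some z)) = f' (Some z)" using ff by (metis comp_apply g_def)
  have "f' (Some z) \<noteq> q" "f' (Some z) \<noteq> r" using f ff z(1) by (metis option.inject option.distinct(1))+
  thus ?thesis using one fix_pt by blast
qed

theorem theorem2p3:
  fixes A B X Y :: "sphere \<Rightarrow> sphere"
  assumes "rational_function A" and "rat_degree A \<ge> 2"
    and "rational_function B" and "rat_degree B \<ge> 2"
    and "mutually_semiconjugate A B"
    and "rational_function X" and "nonconstant X"
    and "rational_function Y" and "nonconstant Y"
    and "B \<circ> Y = Y \<circ> A" and "A \<circ> X = X \<circ> B"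
    and "\<exists>\<nu> :: sphere \<Rightarrow> enat. orbifold \<nu> \<and> signature \<nu> \<noteq> {#2, 2, 2, 2#} \<and>
           orbifold_covering A \<nu> \<nu> \<and> orbifold_covering (X \<circ> Y) \<nu> \<nu>"
  shows "conjugate B A"
proof -
  obtain \<nu> where \<nu>: "orbifold \<nu>" "signature \<nu> \<noteq> {#2, 2, 2, 2#}"
    "orbifold_covering A \<nu> \<nu>" "orbifold_covering (X \<circ> Y) \<nu> \<nu>"
    using assms(12) by blast
  have ncB: "nonconstant B"
    unfolding nonconstant_def
  proof
    assume "\<exists>c. \<forall>x. B x = c"
    then obtain c where "\<And>x. B x = c" by blast
    hence "Y (A x) = c" for x using fun_cong[OF assms(10), of x] by simp
    hence "\<not> nonconstant (Y \<circ> A)" by (auto simp: nonconstant_def)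
    thus False
      using nonconstant_compose[OF assms(9,1)] \<nu>(3) by (simp add: orbifold_covering_def)
  qed
  obtain \<nu>' where \<nu>': "orbifold \<nu>'" "orbifold_covering Y \<nu> \<nu>'" "orbifold_covering X \<nu>' \<nu>"
    "orbifold_covering B \<nu>' \<nu>'"
    using intermediate_orbifold[OF \<nu>(1,3,4) assms(6-9) assms(3) ncB assms(11)] .
  obtain n b c p q r where type: "euclidean_type n b c" and m: "marked \<nu> n b c p q r"
    using euclidean_classification[OF \<nu>(1-3) assms(2)] by blast
  have "signature \<nu>' \<noteq> {#2, 2, 2, 2#}"
    by (rule signature_2222_not_covered[OF \<nu>'(1,2) type m])
  then obtain n' b' c' p' q' r' where type': "euclidean_type n' b' c'"
    and m'': "marked \<nu>' n' b' c' p' q' r'"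
    using euclidean_classification[OF \<nu>'(1) _ \<nu>'(4) assms(4)] by blast
  have "n' = n \<and> b' = b \<and> c' = c"
    by (rule euclidean_type_unique[OF type type' m m'' \<nu>'(2,3)])
  hence m': "marked \<nu>' n b c p' q' r'" using m'' by simp
  note max = covering_preserves_maximal_index[OF type]
  show ?thesis
  proof (cases "\<exists>s. \<nu> s = enat n \<and> A s = s")
    case True
    then obtain s where s: "\<nu> s = enat n" "A s = s" by blast
    \<comment> \<open>Match \<open>s\<close> with \<open>Y s\<close>.\<close>
    have "\<nu>' (Y s) = enat n" by (rule max[OF m' \<nu>'(2) s(1)])
    moreover have "B (Y s) = Y s" using fun_cong[OF assms(10), of s] s(2) by simp
    moreover obtain q\<^sub>1 r\<^sub>1 where "marked \<nu> n b c s q\<^sub>1 r\<^sub>1"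
      using marked_permute[OF type m s(1)] by blast
    moreover obtain q\<^sub>2 r\<^sub>2 where "marked \<nu>' n b c (Y s) q\<^sub>2 r\<^sub>2"
      using marked_permute[OF type m' calculation(1)] by blast
    ultimately show ?thesis
      using conjugate_if_matching_points[OF type _ _ \<nu>(3) \<nu>'(4,2) assms(10)] s(2) by blast
  next
    case False
    have "n \<noteq> 1"
    proof
      assume "n = 1"
      hence "b = \<infinity>" "c = \<infinity>" using type by (auto simp: euclidean_type_def)
      hence "\<exists>x. \<nu> x = 1 \<and> A x = x"
        using regular_fixed_point[OF \<nu>(3) assms(2)] m \<open>n = 1\<close> by blast
      thus False using False \<open>n = 1\<close> by (simp add: one_enat_def)
    qed
    \<comment> \<open>Match \<open>p\<close> with \<open>p'\<close> and \<open>A p\<close> with \<open>B p'\<close>; this needs \<open>A p \<noteq> p\<close> and \<open>B p' \<noteq> p'\<close>.\<close>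
    have p: "\<nu> p = enat n" "\<nu>' p' = enat n" using m m' by (simp_all add: marked_def)
    have Ap: "\<nu> (A p) = enat n" "A p \<noteq> p" using max[OF m \<nu>(3) p(1)] False p(1) by blast+
    have Bp: "\<nu>' (B p') = enat n" by (rule max[OF m' \<nu>'(4) p(2)])
    have "B p' \<noteq> p'"
    proof
      assume "B p' = p'"
      hence "A (X p') = X p'" using fun_cong[OF assms(11), of p'] by simp
      thus False using max[OF m \<nu>'(3) p(2)] False by blast
    qed
    obtain r\<^sub>1 where m1: "marked \<nu> n b c p (A p) r\<^sub>1"
      using marked_permute_two[OF type \<open>n \<noteq> 1\<close> m p(1) Ap(1)] Ap(2) by metis
    obtain r\<^sub>2 where m2: "marked \<nu>' n b c p' (B p') r\<^sub>2"
      using marked_permute_two[OF type \<open>n \<noteq> 1\<close> m' p(2) Bp] \<open>B p' \<noteq> p'\<close> by metis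
    have "b = enat n" using m1 Ap(1) by (simp add: marked_def)
    thus ?thesis
      using conjugate_if_matching_points[OF type m1 m2 \<nu>(3) \<nu>'(4,2) assms(10)] by blast
  qed
qed

end
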